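(* Fix an integer $m\ge2$, $k=2$ or $k=3$, and constants $\chi_0=1$, $\chi_1,\dots,\chi_m\ge0$. Let $\{p_j\}_{j\ge0}$ be the monic Legendre orthogonal polynomials and $\{\tilde s_n\}_{n\ge0}$ the monic orthogonal polynomials with respect to $$\langle f,g\rangle_{S^m}=\sum_{\ell=0}^m\chi_\ell\int_{SG}\Delta^\ell f\,\Delta^\ell g\,d\mu,$$ both of the family $k$, and set $\tilde s_j:=0$ for $j<0$. For $j\ge0$ let $\mathcal F_{m+j}=\mathcal G^mp_j$. Then for every $n\ge-1$ $$\mathcal F_{n+m+1}=\tilde s_{n+m+1}+\sum_{\ell=0}^{2m-1}a_{n,\ell}\,\tilde s_{n+m-\ell},\qquad a_{n,\ell}=\frac{\langle\mathcal F_{n+m+1},\tilde s_{n+m-\ell}\rangle_{S^m}}{\langle\tilde s_{n+m-\ell},\tilde s_{n+m-\ell}\rangle_{S^m}}$$ (terms with $n+m-\ell<0$ are $0$).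
   Context: Sierpinski gasket: let $q_0=(\tfrac12,\tfrac{\sqrt3}{2})$, $q_1=(0,0)$, $q_2=(1,0)$, $V_0=\{q_0,q_1,q_2\}$, $F_i(x)=\tfrac12(x-q_i)+q_i$, and let $SG\subset\mathbb R^2$ be the unique nonempty compact set with $SG=\bigcup_{i=0}^2F_i(SG)$. For a word $w=(w_1,\dots,w_r)\in\{0,1,2\}^r$, $|w|=r$, put $F_w=F_{w_1}\circ\cdots\circ F_{w_r}$; $F_w(SG)$ is called an $r$-cell; $V_r=\bigcup_{|w|=r}F_w(V_0)$; distinct $x,y\in V_r$ satisfy $x\sim_r y$ if they lie in a common $r$-cell. $\mu$ is the self-similar Borel probability measure with $\mu(F_w(SG))=3^{-|w|}$. All functions are real-valued. Energy and Laplacian: $\mathscr E(u,v)=\lim_{r\to\infty}(3/5)^{-r}\sum_{x\sim_r y}(u(x)-u(y))(v(x)-v(y))$ (sum over unordered pairs), and $u\in\operatorname{dom}\mathscr E$ if $\mathscr E(u,u)$ exists and is finite. For $u\in\operatorname{dom}\mathscr E$ and $f$ continuous, $\Delta u=f$ means $\mathscr E(u,v)=-\int_{SG}fv\,d\mu$ for all $v\in\operatorname{dom}\mathscr E$ vanishing on $V_0$. Indices of $q_i$ are mod 3. Normal derivative: $\partial_nu(q_i)=\lim_r(5/3)^r(2u(q_i)-u(F_i^rq_{i+1})-u(F_i^rq_{i-1}))$. Tangential derivative: $\partial_Tu(q_i)=\lim_r5^r(u(F_i^rq_{i+1})-u(F_i^rq_{i-1}))$. Green operator: for $f$ continuous,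 $\mathcal Gf=-\int_{SG}G(\cdot,y)f(y)\,d\mu(y)$ is the unique function with $\Delta(\mathcal Gf)=f$ and $\mathcal Gf|_{V_0}=0$ ($G$ the Dirichlet Green's function); $\mathcal G^m$ is its $m$-fold composition. Monomials: for $j\ge0$, $k\in\{1,2,3\}$, $P_{j,k}$ is the unique function with $\Delta^{j+1}P_{j,k}=0$ such that for all $0\le n\le j$: $\Delta^nP_{j,k}(q_0)=\delta_{nj}\delta_{k1}$, $\partial_n\Delta^nP_{j,k}(q_0)=\delta_{nj}\delta_{k2}$, $\partial_T\Delta^nP_{j,k}(q_0)=\delta_{nj}\delta_{k3}$. In particular $\Delta P_{j,k}=P_{j-1,k}$ with $P_{-1,k}=0$. Orthogonal polynomials: for fixed $k$, $\{p_n\}$ and $\{\tilde s_n\}$ are obtained from $P_{0,k},P_{1,k},\dots$ by Gram-Schmidt without normalization with respect to $\langle f,g\rangle_2=\int_{SG}fg\,d\mu$ and $\langle\cdot,\cdot\rangle_{S^m}$ respectively; i.e. each of $p_n$, $\tilde s_n$ equals $P_{n,k}$ plus a linear combination of $P_{0,k},\dots,P_{n-1,k}$ and is orthogonal to $P_{0,k},\dots,P_{n-1,k}$. *)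

theory Defs
  imports "HOL-Probability.Probability"
begin

type_synonym plane = "real \<times> real"

text \<open>Vertex indices are natural numbers read modulo 3, so \<open>q_{i-1}\<close> is
  rendered as \<open>sg_vertex (i + 2)\<close>.\<close>

definition sg_vertex :: "nat \<Rightarrow> plane" where
  "sg_vertex i =
     (if i mod 3 = 0 then (1/2, sqrt 3 / 2) else if i mod 3 = 1 then (0, 0) else (1, 0))"

definition sg_map :: "nat \<Rightarrow> plane \<Rightarrow> plane" where
  "sg_map i x = (1/2) *\<^sub>R (x - sg_vertex i) + sg_vertex i"

definition sg_V0 :: "plane set" where
  "sg_V0 = {sg_vertex 0, sg_vertex 1, sg_vertex 2}"

definition SG :: "plane set" where
  "SG = (THE K. K \<noteq> {} \<and> compact K \<and> K = (\<Union>i<3. sg_map i ` K))"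

definition sg_words :: "nat \<Rightarrow> nat list set" where
  "sg_words r = {w. length w = r \<and> set w \<subseteq> {..<3}}"

definition sg_word_map :: "nat list \<Rightarrow> plane \<Rightarrow> plane" where
  "sg_word_map w = foldr (\<lambda>i g. sg_map i \<circ> g) w id"

definition sg_cell :: "nat list \<Rightarrow> plane set" where
  "sg_cell w = sg_word_map w ` SG"

definition sg_V :: "nat \<Rightarrow> plane set" where
  "sg_V r = (\<Union>w\<in>sg_words r. sg_word_map w ` sg_V0)"

definition sg_adj :: "nat \<Rightarrow> plane \<Rightarrow> plane \<Rightarrow> bool" where
  "sg_adj r x y \<longleftrightarrow>
     x \<in> sg_V r \<and> y \<in> sg_V r \<and> x \<noteq> y \<and> (\<exists>w\<in>sg_words r. x \<in> sg_cell w \<and> y \<in> sg_cell w)"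

text \<open>The measure lives on all Borel sets of the plane and is concentrated on \<open>SG\<close>
  (take the empty word).\<close>

definition sg_measure :: "plane measure" where
  "sg_measure = (THE M. prob_space M \<and> sets M = sets borel
     \<and> (\<forall>A\<in>sets borel. measure M A = (\<Sum>i<3. measure M (sg_map i -` A)) / 3)
     \<and> (\<forall>r. \<forall>w\<in>sg_words r. measure M (sg_cell w) = 1 / 3 ^ r))"

text \<open>A function on \<open>SG\<close> is represented by a function on the plane; only its values on
  \<open>SG\<close> matter. Operators producing functions return the representative vanishing
  off \<open>SG\<close>.\<close>

text \<open>The sum runs over ordered pairs, so the factor \<open>1/2\<close> turns it into the sum over
  unordered pairs.\<close>

definition sg_graph_energy :: "nat \<Rightarrow> (plane \<Rightarrow> real) \<Rightarrow> (plane \<Rightarrow> real) \<Rightarrow> real" where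
  "sg_graph_energy r u v =
     1 / (3/5) ^ r * ((\<Sum>(x, y)\<in>{(x, y). sg_adj r x y}. (u x - u y) * (v x - v y)) / 2)"

definition sg_energy :: "(plane \<Rightarrow> real) \<Rightarrow> (plane \<Rightarrow> real) \<Rightarrow> real" where
  "sg_energy u v = lim (\<lambda>r. sg_graph_energy r u v)"

text \<open>The graph energies only see the countable set of all vertices; as usual, a function of
  finite energy is identified with its continuous extension to \<open>SG\<close>, whence the
  continuity requirement.\<close>

definition sg_dom_energy :: "(plane \<Rightarrow> real) set" where
  "sg_dom_energy = {u. continuous_on SG u \<and> convergent (\<lambda>r. sg_graph_energy r u u)}"

definition has_sg_laplacian :: "(plane \<Rightarrow> real) \<Rightarrow> (plane \<Rightarrow> real) \<Rightarrow> bool" where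
  "has_sg_laplacian u f \<longleftrightarrow> u \<in> sg_dom_energy \<and> continuous_on SG f \<and>
     (\<forall>v\<in>sg_dom_energy. (\<forall>x\<in>sg_V0. v x = 0) \<longrightarrow>
        sg_energy u v = - (LINT x:SG|sg_measure. f x * v x))"

definition sg_dom_laplacian :: "(plane \<Rightarrow> real) set" where
  "sg_dom_laplacian = {u. \<exists>f. has_sg_laplacian u f}"

definition sg_laplacian :: "(plane \<Rightarrow> real) \<Rightarrow> plane \<Rightarrow> real" where
  "sg_laplacian u = (THE f. has_sg_laplacian u f \<and> (\<forall>x. x \<notin> SG \<longrightarrow> f x = 0))"

definition has_normal_deriv :: "(plane \<Rightarrow> real) \<Rightarrow> nat \<Rightarrow> real \<Rightarrow> bool" where
  "has_normal_deriv u i d \<longleftrightarrow>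
     (\<lambda>r. (5/3) ^ r * (2 * u (sg_vertex i)
         - u ((sg_map i ^^ r) (sg_vertex (i + 1)))
         - u ((sg_map i ^^ r) (sg_vertex (i + 2))))) \<longlonglongrightarrow> d"

definition has_tangential_deriv :: "(plane \<Rightarrow> real) \<Rightarrow> nat \<Rightarrow> real \<Rightarrow> bool" where
  "has_tangential_deriv u i d \<longleftrightarrow>
     (\<lambda>r. 5 ^ r * (u ((sg_map i ^^ r) (sg_vertex (i + 1)))
         - u ((sg_map i ^^ r) (sg_vertex (i + 2))))) \<longlonglongrightarrow> d"

definition sg_green :: "(plane \<Rightarrow> real) \<Rightarrow> plane \<Rightarrow> real" where
  "sg_green f = (THE u. has_sg_laplacian u f \<and> (\<forall>x\<in>sg_V0. u x = 0) \<and>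
     (\<forall>x. x \<notin> SG \<longrightarrow> u x = 0))"

text \<open>\<open>is_sg_monomial j k Q\<close> is the specification that determines \<open>P_{j,k}\<close> on
  \<open>SG\<close>. Membership of the iterates in the domain of the Laplacian is spelled out because
  \<^const>\<open>sg_laplacian\<close> is a total function.\<close>

definition is_sg_monomial :: "nat \<Rightarrow> nat \<Rightarrow> (plane \<Rightarrow> real) \<Rightarrow> bool" where
  "is_sg_monomial j k Q \<longleftrightarrow>
     (\<forall>n\<le>j. (sg_laplacian ^^ n) Q \<in> sg_dom_laplacian) \<and>
     (\<forall>x\<in>SG. (sg_laplacian ^^ (j + 1)) Q x = 0) \<and>
     (\<forall>n\<le>j.
        (sg_laplacian ^^ n) Q (sg_vertex 0) = of_bool (n = j \<and> k = 1) \<and>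
        has_normal_deriv ((sg_laplacian ^^ n) Q) 0 (of_bool (n = j \<and> k = 2)) \<and>
        has_tangential_deriv ((sg_laplacian ^^ n) Q) 0 (of_bool (n = j \<and> k = 3)))"

definition sg_inner :: "(plane \<Rightarrow> real) \<Rightarrow> (plane \<Rightarrow> real) \<Rightarrow> real" where
  "sg_inner f g = (LINT x:SG|sg_measure. f x * g x)"

definition sg_sobolev_inner ::
  "nat \<Rightarrow> (nat \<Rightarrow> real) \<Rightarrow> (plane \<Rightarrow> real) \<Rightarrow> (plane \<Rightarrow> real) \<Rightarrow> real" where
  "sg_sobolev_inner m chi f g =
     (\<Sum>l\<le>m. chi l * (LINT x:SG|sg_measure. (sg_laplacian ^^ l) f x * (sg_laplacian ^^ l) g x))"

definition monic_orthogonal_polys ::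
  "((plane \<Rightarrow> real) \<Rightarrow> (plane \<Rightarrow> real) \<Rightarrow> real) \<Rightarrow> (nat \<Rightarrow> plane \<Rightarrow> real) \<Rightarrow>
   (nat \<Rightarrow> plane \<Rightarrow> real) \<Rightarrow> bool" where
  "monic_orthogonal_polys ip P p \<longleftrightarrow>
     (\<forall>n. (\<exists>c. \<forall>x\<in>SG. p n x = P n x + (\<Sum>i<n. c i * P i x)) \<and> (\<forall>i<n. ip (p n) (P i) = 0))"

end

theory Submission
  imports Defs
begin

text \<open>The Green operator raises the degree by one: \<open>P\<^sub>j\<^sub>+\<^sub>1\<close> is an antiderivative of \<open>P\<^sub>j\<close>, it vanishes at \<open>q\<^sub>0\<close>,
  and by reflection symmetry its values at \<open>q\<^sub>1\<close> and \<open>q\<^sub>2\<close> are proportional to those of the harmonic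
  function \<open>P\<^sub>0\<close>, so \<open>\<G> P\<^sub>j = P\<^sub>j\<^sub>+\<^sub>1 - c P\<^sub>0\<close>. Hence \<open>\<G>\<^sup>m p\<^sub>j\<close> is monic of degree \<open>m + j\<close>. As \<open>\<G>\<close> is
  self-adjoint, \<open>\<langle>\<Delta>\<^sup>l \<G>\<^sup>m p\<^sub>j, \<Delta>\<^sup>l g\<rangle> = \<langle>p\<^sub>j, \<G>\<^sup>m\<^sup>-\<^sup>l \<Delta>\<^sup>l g\<rangle> = 0\<close> for \<open>l \<le> m\<close> whenever \<open>deg g + m < j\<close>, so only
  the \<open>2 m\<close> orthogonal polynomials of next lower degree occur in its expansion.

  Uniqueness of \<open>\<Delta> u\<close> needs many test functions of finite energy; they are glued from harmonic
  functions with prescribed boundary values, which are uniform limits of the energy minimising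
  subdivision rule. The symmetry comes from uniqueness of the self-similar measure and of the
  monomials, the latter because a harmonic function is determined by its jet at \<open>q\<^sub>0\<close>.\<close>

section \<open>Geometry of the gasket and graph energies\<close>

text \<open>Gasket, measure, Laplacian and Green operator are definite descriptions, so each needs a
  uniqueness proof and a concrete witness before anything can be computed. The gasket is realised as
  the closure of the vertex set, the measure as the law of a random digit expansion. No Green kernel
  is built: for \<open>f\<close> in the span of the \<open>P j\<close> an explicit function with
  Laplacian \<open>f\<close> and zero boundary values lies in the next larger span, and uniqueness
  identifies it with \<open>sg_green f\<close>. This is where the family matters: for k = 1 the
  harmonic member is the constant 1, no multiple of which cancels the nonzero boundary values of a
  function that vanishes at q_0. Functions count only through their values on \<open>SG\<close>,
  hence most identities are pointwise on \<open>SG\<close> and are transported by congruence lemmas.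
  The number 2 m adds two shifts: the m-fold Green operator lifts the top index from j to j + m, and
  orthogonality sets in only below j - m. The indices j - m, ..., j + m - 1 remain.\<close>

definition bary :: "nat \<Rightarrow> plane \<Rightarrow> real" where
  "bary i z = (if i = 0 then 2 * snd z / sqrt 3
     else if i = 1 then 1 - fst z - snd z / sqrt 3 else fst z - snd z / sqrt 3)"

lemma less_3_cases: "i < 3 \<longleftrightarrow> i = 0 \<or> i = 1 \<or> i = (2::nat)"
  by auto

lemma lessThan_3: "{..<(3::nat)} = {0, 1, 2}"
  by auto

lemma sum_less_3: "(\<Sum>i<(3::nat). f i) = f 0 + f 1 + (f 2 :: 'a :: comm_monoid_add)"
  by (simp add: numeral_3_eq_3 numeral_2_eq_2)

lemma sg_vertex_mod [simp]: "sg_vertex (i mod 3) = sg_vertex i"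
  by (simp add: sg_vertex_def)

lemma sg_map_mod [simp]: "sg_map (i mod 3) = sg_map i"
  by (simp add: sg_map_def fun_eq_iff)

lemma bary_vertex: "i < 3 \<Longrightarrow> j < 3 \<Longrightarrow> bary i (sg_vertex j) = of_bool (i = j)"
  by (auto simp: less_3_cases bary_def sg_vertex_def)

text \<open>\<open>bary\<close> is the barycentric coordinate system of the triangle of vertices. A
  contraction towards a vertex acts affinely on it, so the question how cells meet becomes one of
  inequalities between coordinates in [0, 1].\<close>

lemma bary_map: "i < 3 \<Longrightarrow> j < 3 \<Longrightarrow> bary i (sg_map j x) = (bary i x + of_bool (i = j)) / 2"
  by (auto simp: less_3_cases bary_def sg_vertex_def sg_map_def field_simps)

lemma bary_sum: "bary 0 x + bary 1 x + bary 2 x = 1"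
  by (simp add: bary_def)

lemma bary_eqI: "bary 0 x = bary 0 y \<Longrightarrow> bary 2 x = bary 2 y \<Longrightarrow> x = y"
  by (simp add: bary_def prod_eq_iff)

lemma continuous_on_bary [continuous_intros]: "continuous_on S (bary i)"
  unfolding bary_def by (cases "i = 0"; cases "i = 1") (auto intro!: continuous_intros)

lemma sg_map_alt: "sg_map i x = (1/2) *\<^sub>R x + (1/2) *\<^sub>R sg_vertex i"
  by (simp add: sg_map_def prod_eq_iff field_simps)

lemma dist_sg_map [simp]: "dist (sg_map i x) (sg_map i y) = dist x y / 2"
  by (simp add: sg_map_alt dist_norm flip: scaleR_diff_right)

lemma sg_map_inj [simp]: "sg_map i x = sg_map i y \<longleftrightarrow> x = y"
  by (simp add: sg_map_alt)

lemma continuous_on_sg_map [continuous_intros]: "continuous_on S (sg_map i)"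
  unfolding sg_map_def by (intro continuous_intros)

lemma sg_map_fixes_vertex [simp]: "sg_map i (sg_vertex i) = sg_vertex i"
  by (simp add: sg_map_def)

lemma sg_map_vertex_commute: "sg_map i (sg_vertex j) = sg_map j (sg_vertex i)"
  by (simp add: sg_map_alt)

lemma norm_sg_vertex_le: "norm (sg_vertex i) \<le> 1"
  by (auto simp: sg_vertex_def norm_Pair power2_eq_square)

lemma sg_V0_eq: "sg_V0 = sg_vertex ` {..<3}"
  by (simp add: sg_V0_def lessThan_3)

section \<open>Words and vertex sets\<close>

lemma sg_words_0 [simp]: "sg_words 0 = {[]}"
  by (auto simp: sg_words_def)

lemma sg_words_Suc: "sg_words (Suc r) = (\<Union>i<3. (#) i ` sg_words r)"
  by (force simp: sg_words_def length_Suc_conv)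

lemma sg_word_map_Nil [simp]: "sg_word_map [] = id"
  and sg_word_map_Cons [simp]: "sg_word_map (i # w) = sg_map i \<circ> sg_word_map w"
  by (simp_all add: sg_word_map_def)

lemma sg_V_0 [simp]: "sg_V 0 = sg_V0"
  by (simp add: sg_V_def)

lemma sg_V_Suc: "sg_V (Suc r) = (\<Union>i<3. sg_map i ` sg_V r)"
  unfolding sg_V_def sg_words_Suc by (simp add: image_UN image_comp) blast

lemma finite_sg_V [simp]: "finite (sg_V r)"
  by (induction r) (auto simp: sg_V_Suc sg_V0_def)

lemma sg_V_mono: "sg_V r \<subseteq> sg_V (Suc r)"
proof (induction r)
  case 0
  show ?case
    by (force simp: sg_V_Suc sg_V0_eq image_iff)
next
  case (Suc r)
  then show ?case
    unfolding sg_V_Suc [of "Suc r"] sg_V_Suc [of r] by (intro UN_mono image_mono) auto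
qed

definition sg_Vstar :: "plane set" where
  "sg_Vstar = (\<Union>r. sg_V r)"

lemma sg_Vstar_invariant: "sg_Vstar = (\<Union>i<3. sg_map i ` sg_Vstar)"
proof -
  have "(\<Union>i<3. sg_map i ` sg_Vstar) = (\<Union>r. sg_V (Suc r))"
    unfolding sg_Vstar_def sg_V_Suc by blast
  also have "\<dots> = sg_Vstar"
    unfolding sg_Vstar_def using sg_V_mono by blast
  finally show ?thesis ..
qed

lemma sg_Vstar_subset_cball: "sg_Vstar \<subseteq> cball 0 1"
proof -
  have "sg_V r \<subseteq> cball 0 1" for r
  proof (induction r)
    case 0
    show ?case by (auto simp: sg_V0_def norm_sg_vertex_le)
  next
    case (Suc r)
    have "norm (sg_map i x) \<le> 1" if "norm x \<le> 1" for i x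
      using norm_triangle_ineq [of "(1/2) *\<^sub>R x" "(1/2) *\<^sub>R sg_vertex i"]
        norm_sg_vertex_le [of i] that by (simp add: sg_map_alt)
    with Suc show ?case
      by (fastforce simp: sg_V_Suc)
  qed
  then show ?thesis
    by (auto simp: sg_Vstar_def)
qed

section \<open>Existence and uniqueness of the gasket\<close>

definition sg_attractor :: "plane set \<Rightarrow> bool" where
  "sg_attractor K \<longleftrightarrow> K \<noteq> {} \<and> compact K \<and> K = (\<Union>i<3. sg_map i ` K)"

text \<open>Invariance survives closure: a continuous map sends closure into closure, and the image
  of the compact closure is closed, so \<open>sg_map i\<close> commutes with taking the closure
  here.\<close>

lemma sg_attractor_closure_Vstar: "sg_attractor (closure sg_Vstar)"
  unfolding sg_attractor_def
proof (intro conjI)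
  show "closure sg_Vstar \<noteq> {}"
    by (auto simp: sg_Vstar_def sg_V0_def intro!: exI [of _ 0])
  show comp: "compact (closure sg_Vstar)"
    using bounded_subset [OF bounded_cball sg_Vstar_subset_cball] by (simp add: compact_closure)
  have "sg_map i ` closure sg_Vstar = closure (sg_map i ` sg_Vstar)" for i
  proof
    show "sg_map i ` closure sg_Vstar \<subseteq> closure (sg_map i ` sg_Vstar)"
      by (intro image_closure_subset) (auto intro!: continuous_intros closure_subset)
    show "closure (sg_map i ` sg_Vstar) \<subseteq> sg_map i ` closure sg_Vstar"
      using comp
      by (intro closure_minimal compact_imp_closed compact_continuous_image)
        (auto intro!: continuous_intros intro: closure_subset [THEN subsetD])
  qed
  then show "closure sg_Vstar = (\<Union>i<3. sg_map i ` closure sg_Vstar)"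
    by (subst sg_Vstar_invariant) (simp add: lessThan_3)
qed

text \<open>Take the point x of \<open>K\<close> farthest from \<open>L\<close> and write x =
  \<open>sg_map i y\<close>. Contraction bounds its distance to \<open>L\<close> by half that of y,
  hence by half the maximum, so the maximum is 0. Exchanging the roles gives uniqueness.\<close>

lemma sg_attractor_subset:
  assumes K: "sg_attractor K" and L: "sg_attractor L"
  shows "K \<subseteq> L"
proof -
  have "L \<noteq> {}" "closed L" "K \<noteq> {}" "compact K"
    using K L by (auto simp: sg_attractor_def compact_imp_closed)
  have "continuous_on K (\<lambda>x. infdist x L)"
    by (intro continuous_intros)
  then obtain x where x: "x \<in> K" "\<And>y. y \<in> K \<Longrightarrow> infdist y L \<le> infdist x L"
    using continuous_attains_sup [OF \<open>compact K\<close> \<open>K \<noteq> {}\<close>] by metis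
  obtain i y where i: "i < 3" and y: "y \<in> K" "x = sg_map i y"
    using x(1) K unfolding sg_attractor_def by blast
  obtain z where z: "z \<in> L" "infdist y L = dist y z"
    using infdist_attains_inf [OF \<open>closed L\<close> \<open>L \<noteq> {}\<close>] by metis
  have "sg_map i z \<in> L"
    using L z(1) i unfolding sg_attractor_def by blast
  then have "infdist x L \<le> dist y z / 2"
    using infdist_le [of "sg_map i z" L x] y(2) by simp
  then have "infdist x L \<le> 0"
    using x(2) [OF y(1)] z(2) infdist_nonneg [of x L] by linarith
  then show "K \<subseteq> L"
    using x(2) \<open>closed L\<close> \<open>L \<noteq> {}\<close>
    by (metis in_closed_iff_infdist_zero infdist_nonneg order.antisym order.trans subsetI)
qed

lemma SG_unique: "sg_attractor K \<Longrightarrow> SG = K"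
  unfolding SG_def sg_attractor_def [symmetric]
  by (metis (mono_tags, lifting) the_equality sg_attractor_subset subset_antisym)

lemma sg_attractor_SG: "sg_attractor SG"
  using SG_unique sg_attractor_closure_Vstar by metis

lemma SG_eq_closure: "SG = closure sg_Vstar"
  by (rule SG_unique [OF sg_attractor_closure_Vstar])

lemma SG_nonempty: "SG \<noteq> {}" and compact_SG: "compact SG"
  and SG_invariant: "SG = (\<Union>i<3. sg_map i ` SG)"
  using sg_attractor_SG unfolding sg_attractor_def by blast+

lemma closed_SG: "closed SG"
  by (simp add: compact_SG compact_imp_closed)

lemma sg_map_in_SG [intro]: "x \<in> SG \<Longrightarrow> sg_map i x \<in> SG"
  by (subst SG_invariant) (auto intro!: bexI [of _ "i mod 3"])

lemma SG_cases:
  assumes "x \<in> SG"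
  obtains i y where "i < 3" "y \<in> SG" "x = sg_map i y"
  using assms by (subst (asm) SG_invariant) auto

lemma sg_Vstar_subset_SG: "sg_Vstar \<subseteq> SG"
  by (simp add: SG_eq_closure closure_subset)

lemma sg_V_subset_SG: "sg_V r \<subseteq> SG"
  using sg_Vstar_subset_SG by (auto simp: sg_Vstar_def)

lemma sg_vertex_in_SG [simp, intro]: "sg_vertex i \<in> SG"
proof -
  have "sg_vertex (i mod 3) \<in> sg_V 0"
    unfolding sg_V_0 sg_V0_eq by (intro imageI) simp
  then show ?thesis using sg_V_subset_SG [of 0] by auto
qed

lemma sg_word_map_in_SG [intro]: "x \<in> SG \<Longrightarrow> sg_word_map w x \<in> SG"
  by (induction w) auto

lemma dist_SG_le:
  assumes "x \<in> SG" "y \<in> SG" shows "dist x y \<le> 2"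
proof -
  have "SG \<subseteq> cball 0 1"
    unfolding SG_eq_closure by (rule closure_minimal [OF sg_Vstar_subset_cball]) simp
  then have "norm x \<le> 1" "norm y \<le> 1"
    using assms by auto
  then show ?thesis
    using norm_triangle_ineq4 [of x y] by (simp add: dist_norm)
qed

lemma bary_nonneg:
  assumes "x \<in> SG" "i < 3" shows "bary i x \<ge> 0"
proof -
  have "sg_V r \<subseteq> {x. bary i x \<ge> 0}" for r
    by (induction r)
      (use \<open>i < 3\<close> in \<open>auto simp: sg_V_Suc bary_map sg_V0_eq bary_vertex\<close>)
  then have "sg_Vstar \<subseteq> {x. bary i x \<ge> 0}"
    by (auto simp: sg_Vstar_def)
  moreover have "closed {x. bary i x \<ge> 0}"
    by (intro closed_Collect_le continuous_intros)
  ultimately show ?thesis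
    using assms(1) closure_minimal unfolding SG_eq_closure by blast
qed

section \<open>How cells intersect\<close>

lemma bary_1_imp_vertex:
  assumes "x \<in> SG" "j < 3" "bary j x = 1"
  shows "x = sg_vertex j"
proof -
  have "bary 0 x \<ge> 0" "bary 1 x \<ge> 0" "bary 2 x \<ge> 0"
    using assms(1) bary_nonneg by auto
  then have "bary 0 x = of_bool (j = 0)" "bary 2 x = of_bool (j = 2)"
    using assms(2,3) bary_sum [of x] by (auto simp: less_3_cases)
  then show ?thesis
    using assms(2) by (intro bary_eqI) (auto simp: bary_vertex)
qed

lemma bary_le_1: "x \<in> SG \<Longrightarrow> i < 3 \<Longrightarrow> bary i x \<le> 1"
  using bary_nonneg [of x 0] bary_nonneg [of x 1] bary_nonneg [of x 2] bary_sum [of x]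
  by (auto simp: less_3_cases)

lemma sg_map_eq_vertex:
  assumes "x \<in> SG" "i < 3" "j < 3" "sg_map i x = sg_vertex j"
  shows "i = j \<and> x = sg_vertex j"
proof -
  have "(bary j x + of_bool (j = i)) / 2 = 1"
    using bary_map [of j i x] bary_vertex [of j j] assms by simp
  moreover have "bary j x \<le> 1"
    using assms bary_le_1 by blast
  ultimately have "i = j" "bary j x = 1"
    by (auto split: if_splits simp: of_bool_def)
  then show ?thesis using assms bary_1_imp_vertex by blast
qed

text \<open>Coordinate j is at most 1/2 on cell i and at least 1/2 on cell j, so at a common point
  both bounds are attained; likewise for coordinate i. Two distinct level 1 cells thus meet only at
  F_i(q_j) = F_j(q_i).\<close>

lemma sg_map_eq_sg_map:
  assumes "x \<in> SG" "y \<in> SG" "i < 3" "j < 3" "i \<noteq> j" "sg_map i x = sg_map j y"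
  shows "x = sg_vertex j" "y = sg_vertex i"
proof -
  have 1: "(bary j x + of_bool (j = i)) / 2 = (bary j y + of_bool (j = j)) / 2"
    "(bary i x + of_bool (i = i)) / 2 = (bary i y + of_bool (i = j)) / 2"
    using bary_map [of j i x] bary_map [of j j y] bary_map [of i i x] bary_map [of i j y] assms
    by simp_all
  moreover have "bary j x \<le> 1" "bary j y \<ge> 0" "bary i y \<le> 1" "bary i x \<ge> 0"
    using assms bary_le_1 bary_nonneg by blast+
  ultimately have "bary j x = 1" "bary i y = 1"
    using \<open>i \<noteq> j\<close> by auto
  then show "x = sg_vertex j" "y = sg_vertex i" using assms bary_1_imp_vertex by blast+
qed

lemma sg_word_map_eq_vertex:
  assumes "w \<in> sg_words r" "x \<in> SG" "j < 3" "sg_word_map w x = sg_vertex j"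
  shows "x = sg_vertex j"
  using assms
proof (induction r arbitrary: w)
  case (Suc r)
  then obtain i v where v: "i < 3" "v \<in> sg_words r" "w = i # v"
    by (auto simp: sg_words_Suc)
  then have "sg_word_map v x = sg_vertex j"
    using Suc.prems sg_map_eq_vertex [of "sg_word_map v x" i j] by auto
  then show ?case using Suc v by blast
qed auto

text \<open>Adjacency asks for two vertices in a common r-cell, but a vertex may have been produced
  by another cell; it is then a corner of the given cell as well. Equal first letters are stripped;
  otherwise the point is a junction of level 1 cells, whose preimage is a vertex.\<close>

lemma sg_V_Int_cell:
  assumes "w \<in> sg_words r" "v \<in> sg_words r" "x \<in> SG" "a \<in> sg_V0"
    "sg_word_map w x = sg_word_map v a"
  shows "x \<in> sg_V0"
  using assms
proof (induction r arbitrary: w v)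
  case (Suc r)
  then obtain i w' j v' where w: "i < 3" "w' \<in> sg_words r" "w = i # w'"
    and v: "j < 3" "v' \<in> sg_words r" "v = j # v'"
    by (auto simp: sg_words_Suc)
  have a: "a \<in> SG"
    using Suc.prems by (auto simp: sg_V0_eq)
  show ?case
  proof (cases "i = j")
    case True
    then show ?thesis using Suc w v by auto
  next
    case False
    then have "sg_word_map w' x = sg_vertex j"
      using sg_map_eq_sg_map(1) [of "sg_word_map w' x" "sg_word_map v' a" i j] Suc.prems w v a
      by auto
    then show ?thesis
      using sg_word_map_eq_vertex [of w' r x j] w v Suc.prems(3) by (auto simp: sg_V0_eq)
  qed
qed auto

lemma sg_word_map_inj [simp]: "sg_word_map w x = sg_word_map w y \<longleftrightarrow> x = y"
  by (induction w) auto

lemma sg_adj_iff: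
  "sg_adj r x y \<longleftrightarrow>
     (\<exists>w\<in>sg_words r. \<exists>a\<in>sg_V0. \<exists>b\<in>sg_V0. a \<noteq> b \<and> x = sg_word_map w a \<and> y = sg_word_map w b)"
  (is "?L \<longleftrightarrow> ?R")
proof
  assume ?L
  then obtain w a b where "w \<in> sg_words r" "a \<in> SG" "b \<in> SG" "x = sg_word_map w a"
    "y = sg_word_map w b" "x \<in> sg_V r" "y \<in> sg_V r" "x \<noteq> y"
    by (auto simp: sg_adj_def sg_cell_def)
  moreover have "z \<in> sg_V0" if "z \<in> SG" "sg_word_map w z \<in> sg_V r" for z
    using that sg_V_Int_cell [OF \<open>w \<in> sg_words r\<close>, of _ z] unfolding sg_V_def by blast
  ultimately show ?R
    by metis
next
  assume ?R
  then show ?L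
    unfolding sg_adj_def sg_V_def sg_cell_def by (auto simp: sg_V0_eq)
qed

lemma sg_adj_0: "sg_adj 0 x y \<longleftrightarrow> x \<in> sg_V0 \<and> y \<in> sg_V0 \<and> x \<noteq> y"
  by (auto simp: sg_adj_iff)

lemma sg_adj_Suc:
  "sg_adj (Suc r) x y \<longleftrightarrow> (\<exists>i<3. \<exists>x' y'. sg_adj r x' y' \<and> x = sg_map i x' \<and> y = sg_map i y')"
  (is "?L \<longleftrightarrow> ?R")
proof
  assume ?L
  then obtain v a b where v: "v \<in> sg_words (Suc r)" and ab: "a \<in> sg_V0" "b \<in> sg_V0" "a \<noteq> b"
    "x = sg_word_map v a" "y = sg_word_map v b"
    unfolding sg_adj_iff by blast
  from v obtain i w where "i < 3" "w \<in> sg_words r" "v = i # w"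
    unfolding sg_words_Suc by blast
  with ab have "i < 3" "w \<in> sg_words r" "x = sg_map i (sg_word_map w a)" "y = sg_map i (sg_word_map w b)"
    by simp_all
  with ab show ?R
    unfolding sg_adj_iff by metis
next
  assume ?R
  then obtain i x' y' where i: "i < 3" "sg_adj r x' y'" "x = sg_map i x'" "y = sg_map i y'"
    by blast
  then obtain w a b where w: "w \<in> sg_words r" "a \<in> sg_V0" "b \<in> sg_V0" "a \<noteq> b"
    "x' = sg_word_map w a" "y' = sg_word_map w b"
    unfolding sg_adj_iff by blast
  with i have "i < 3" "w \<in> sg_words r" "a \<in> sg_V0" "b \<in> sg_V0" "a \<noteq> b"
    "x = sg_word_map (i # w) a" "y = sg_word_map (i # w) b"
    by simp_all
  moreover from this have "i # w \<in> sg_words (Suc r)"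
    by (auto simp: sg_words_Suc)
  ultimately show ?L
    unfolding sg_adj_iff by metis
qed

lemma sg_adj_in_SG: "sg_adj r x y \<Longrightarrow> x \<in> SG \<and> y \<in> SG"
  using sg_V_subset_SG by (auto simp: sg_adj_def)

lemma finite_sg_adj [simp]: "finite {(x, y). sg_adj r x y}"
  by (rule finite_subset [of _ "sg_V r \<times> sg_V r"]) (auto simp: sg_adj_def)

section \<open>Graph energies under subdivision\<close>

definition sg_form :: "(plane \<Rightarrow> real) \<Rightarrow> (plane \<Rightarrow> real) \<Rightarrow> real" where
  "sg_form u v =
     (u (sg_vertex 0) - u (sg_vertex 1)) * (v (sg_vertex 0) - v (sg_vertex 1)) +
     (u (sg_vertex 1) - u (sg_vertex 2)) * (v (sg_vertex 1) - v (sg_vertex 2)) +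
     (u (sg_vertex 0) - u (sg_vertex 2)) * (v (sg_vertex 0) - v (sg_vertex 2))"

lemma sg_vertex_inj [simp]:
  "sg_vertex 0 \<noteq> sg_vertex 1" "sg_vertex 0 \<noteq> sg_vertex 2" "sg_vertex 1 \<noteq> sg_vertex 2"
  "sg_vertex 0 \<noteq> sg_vertex (Suc 0)" "sg_vertex (Suc 0) \<noteq> sg_vertex 2"
  by (auto simp: sg_vertex_def)

lemma sg_graph_energy_0: "sg_graph_energy 0 u v = sg_form u v"
proof -
  define g where "g = (\<lambda>(x, y). (u x - u y) * (v x - v y))"
  \<comment> \<open>Diagonal pairs contribute 0, so the sum may run over the full square.\<close>
  have "sum g {(x, y). sg_adj 0 x y} = sum g (sg_V0 \<times> sg_V0)"
    by (intro sum.mono_neutral_left) (auto simp: sg_adj_0 g_def sg_V0_eq)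
  also have "\<dots> = (\<Sum>x\<in>sg_V0. \<Sum>y\<in>sg_V0. (u x - u y) * (v x - v y))"
    by (simp add: sum.cartesian_product g_def)
  also have "\<dots> = 2 * sg_form u v"
    using sg_vertex_inj by (simp add: sg_V0_def sg_form_def algebra_simps)
  finally show ?thesis
    by (simp add: sg_graph_energy_def g_def)
qed

text \<open>Every edge of level \<open>Suc r\<close> lies in exactly one level 1 cell: an edge in
  two of them would have both ends at their single common point. The factor 5/3 is the ratio of
  consecutive renormalisations.\<close>

lemma sg_graph_energy_Suc:
  "sg_graph_energy (Suc r) u v =
     5/3 * (\<Sum>i<3. sg_graph_energy r (\<lambda>x. u (sg_map i x)) (\<lambda>x. v (sg_map i x)))"
proof -
  define A where "A = {(x, y). sg_adj r x y}"
  define \<phi> where "\<phi> = (\<lambda>i. map_prod (sg_map i) (sg_map i))"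
  define g where "g = (\<lambda>(x, y). (u x - u y) * (v x - v y))"
  have "{(x, y). sg_adj (Suc r) x y} = (\<Union>i<3. \<phi> i ` A)"
    unfolding sg_adj_Suc A_def \<phi>_def by (auto simp: image_iff)
  also have "sum g \<dots> = (\<Sum>i<3. sum g (\<phi> i ` A))"
  proof (rule sum.UNION_disjoint)
    show "\<forall>i\<in>{..<3}. \<forall>j\<in>{..<3}. i \<noteq> j \<longrightarrow> \<phi> i ` A \<inter> \<phi> j ` A = {}"
    proof (intro ballI impI, rule ccontr)
      fix i j :: nat assume ij: "i \<in> {..<3}" "j \<in> {..<3}" "i \<noteq> j" "\<phi> i ` A \<inter> \<phi> j ` A \<noteq> {}"
      then obtain e e' where "e \<in> A" "e' \<in> A" "\<phi> i e = \<phi> j e'"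
        by blast
      then obtain x y x' y' where *: "sg_adj r x y" "sg_adj r x' y'" "sg_map i x = sg_map j x'"
          "sg_map i y = sg_map j y'"
        by (cases e; cases e') (simp add: A_def \<phi>_def)
      then have "x = sg_vertex j" "y = sg_vertex j"
        using ij(1-3) sg_map_eq_sg_map(1) [of x x' i j] sg_map_eq_sg_map(1) [of y y' i j]
          sg_adj_in_SG [OF *(1)] sg_adj_in_SG [OF *(2)] by simp_all
      with * show False by (auto simp: sg_adj_def)
    qed
  qed (auto simp: A_def)
  also have "\<dots> = (\<Sum>i<3. \<Sum>(x, y)\<in>A. (u (sg_map i x) - u (sg_map i y)) * (v (sg_map i x) - v (sg_map i y)))"
  proof (rule sum.cong [OF refl])
    fix i
    have "inj_on (\<phi> i) A"
      unfolding \<phi>_def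
      by (rule inj_on_subset [OF prod.inj_map subset_UNIV]) (auto intro: injI)
    then have "sum g (\<phi> i ` A) = sum (g \<circ> \<phi> i) A"
      by (rule sum.reindex)
    also have "g \<circ> \<phi> i = (\<lambda>(x, y). (u (sg_map i x) - u (sg_map i y)) * (v (sg_map i x) - v (sg_map i y)))"
      by (simp add: fun_eq_iff g_def \<phi>_def)
    finally show "sum g (\<phi> i ` A) = (\<Sum>(x, y)\<in>A. (u (sg_map i x) - u (sg_map i y)) * (v (sg_map i x) - v (sg_map i y)))" .
  qed
  finally show ?thesis
    unfolding sg_graph_energy_def g_def A_def [symmetric] sum_less_3
    by (simp add: add_divide_distrib distrib_left)
qed

section \<open>Functions of finite energy\<close>

lemma sg_graph_energy_cong:
  assumes "\<And>x. x \<in> SG \<Longrightarrow> u x = u' x" "\<And>x. x \<in> SG \<Longrightarrow> v x = v' x"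
  shows "sg_graph_energy r u v = sg_graph_energy r u' v'"
proof -
  have "(\<Sum>(x, y)\<in>{(x, y). sg_adj r x y}. (u x - u y) * (v x - v y)) =
      (\<Sum>(x, y)\<in>{(x, y). sg_adj r x y}. (u' x - u' y) * (v' x - v' y))"
    using assms sg_adj_in_SG by (intro sum.cong) (auto simp: case_prod_unfold)
  then show ?thesis
    by (simp add: sg_graph_energy_def)
qed

lemma sg_graph_energy_commute: "sg_graph_energy r u v = sg_graph_energy r v u"
  by (simp add: sg_graph_energy_def mult.commute)

lemma sg_graph_energy_linear:
  "sg_graph_energy r (\<lambda>x. a * u x + b * v x) w =
     a * sg_graph_energy r u w + b * sg_graph_energy r v w"
proof (induction r arbitrary: u v w)
  case 0
  then show ?case
    by (simp add: sg_graph_energy_0 sg_form_def algebra_simps)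
next
  case (Suc r)
  then show ?case
    by (simp add: sg_graph_energy_Suc sum_less_3 algebra_simps)
qed

lemma sg_graph_energy_nonneg: "sg_graph_energy r u u \<ge> 0"
  by (induction r arbitrary: u)
    (auto simp: sg_graph_energy_0 sg_form_def sg_graph_energy_Suc intro!: sum_nonneg)

text \<open>Pythagoras for one subdivision. \<open>d\<close> is the deviation at a midpoint from the
  minimising value with weights 2/5, 2/5, 1/5. As that value is a critical point, mixed terms
  between boundary values and deviations cancel, and 5/3 is the factor that keeps the minimal energy
  unchanged.\<close>

lemma sg_form_subdivide:
  fixes u v :: "plane \<Rightarrow> real"
  defines "d \<equiv> (\<lambda>w i j k. w (sg_map i (sg_vertex j)) -
     (2 * w (sg_vertex i) + 2 * w (sg_vertex j) + w (sg_vertex k)) / 5 :: real)"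
  shows "5/3 * (\<Sum>i<3. sg_form (\<lambda>x. u (sg_map i x)) (\<lambda>x. v (sg_map i x))) =
     sg_form u v + 5/3 * (2 * (d u 0 1 2 * d v 0 1 2 + d u 1 2 0 * d v 1 2 0 + d u 0 2 1 * d v 0 2 1)
       + (d u 0 1 2 - d u 1 2 0) * (d v 0 1 2 - d v 1 2 0)
       + (d u 0 1 2 - d u 0 2 1) * (d v 0 1 2 - d v 0 2 1)
       + (d u 1 2 0 - d u 0 2 1) * (d v 1 2 0 - d v 0 2 1))"
  unfolding d_def sum_less_3 sg_form_def sg_map_fixes_vertex
    sg_map_vertex_commute [of 1 0] sg_map_vertex_commute [of 2 0] sg_map_vertex_commute [of 2 1]
  by (simp add: field_simps)

lemma sg_form_subdivide_le:
  "sg_form u u \<le> 5/3 * (\<Sum>i<3. sg_form (\<lambda>x. u (sg_map i x)) (\<lambda>x. u (sg_map i x)))"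
  unfolding sg_form_subdivide by simp

lemma sg_graph_energy_le_Suc: "sg_graph_energy r u u \<le> sg_graph_energy (Suc r) u u"
proof (induction r arbitrary: u)
  case 0
  show ?case
    unfolding sg_graph_energy_Suc sg_graph_energy_0 by (rule sg_form_subdivide_le)
next
  case (Suc r)
  show ?case
    unfolding sg_graph_energy_Suc [of "Suc r" u u] sg_graph_energy_Suc [of r u u]
    using Suc by (intro mult_left_mono sum_mono) simp_all
qed

lemma sg_graph_energy_incseq: "incseq (\<lambda>r. sg_graph_energy r u u)"
  by (intro incseq_SucI sg_graph_energy_le_Suc)

lemma sg_dom_energy_iff:
  "u \<in> sg_dom_energy \<longleftrightarrow> continuous_on SG u \<and> (\<exists>C. \<forall>r. sg_graph_energy r u u \<le> C)"
proof -
  have "convergent (\<lambda>r. sg_graph_energy r u u) \<longleftrightarrow> (\<exists>C. \<forall>r. sg_graph_energy r u u \<le> C)"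
  proof
    assume "convergent (\<lambda>r. sg_graph_energy r u u)"
    then obtain L where "(\<lambda>r. sg_graph_energy r u u) \<longlonglongrightarrow> L"
      by (auto simp: convergent_def)
    then show "\<exists>C. \<forall>r. sg_graph_energy r u u \<le> C"
      using incseq_le [OF sg_graph_energy_incseq] by blast
  next
    assume "\<exists>C. \<forall>r. sg_graph_energy r u u \<le> C"
    then obtain C where "\<And>r. sg_graph_energy r u u \<le> C"
      by blast
    then show "convergent (\<lambda>r. sg_graph_energy r u u)"
      using incseq_convergent [OF sg_graph_energy_incseq] by (metis convergentI)
  qed
  then show ?thesis
    by (simp add: sg_dom_energy_def)
qed

lemma sg_dom_energy_continuous: "u \<in> sg_dom_energy \<Longrightarrow> continuous_on SG u"
  by (simp add: sg_dom_energy_def)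

lemma sg_dom_energy_cong:
  assumes "\<And>x. x \<in> SG \<Longrightarrow> u x = v x"
  shows "u \<in> sg_dom_energy \<longleftrightarrow> v \<in> sg_dom_energy"
  using assms sg_graph_energy_cong [of u v u v] continuous_on_cong [of SG SG u v]
  by (simp add: sg_dom_energy_def)

lemma sg_dom_energy_linear:
  assumes "u \<in> sg_dom_energy" "v \<in> sg_dom_energy"
  shows "(\<lambda>x. a * u x + b * v x) \<in> sg_dom_energy"
proof -
  obtain C D where C: "\<And>r. sg_graph_energy r u u \<le> C" and D: "\<And>r. sg_graph_energy r v v \<le> D"
    using assms by (auto simp: sg_dom_energy_iff)
  have quad: "sg_graph_energy r (\<lambda>x. c * u x + e * v x) (\<lambda>x. c * u x + e * v x) =
      c^2 * sg_graph_energy r u u + 2 * c * e * sg_graph_energy r u v + e^2 * sg_graph_energy r v v"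
    for r c e
    using sg_graph_energy_commute [of r u "\<lambda>x. c * u x + e * v x"]
      sg_graph_energy_commute [of r v "\<lambda>x. c * u x + e * v x"]
      sg_graph_energy_commute [of r v u]
    by (simp add: sg_graph_energy_linear algebra_simps power2_eq_square)
  have "sg_graph_energy r (\<lambda>x. a * u x + b * v x) (\<lambda>x. a * u x + b * v x) \<le> 2 * (a^2 * C + b^2 * D)"
    for r
  proof -
    \<comment> \<open>Nonnegativity of the energy of a u - b v bounds the mixed term.\<close>
    have "2 * a * b * sg_graph_energy r u v \<le> a^2 * sg_graph_energy r u u + b^2 * sg_graph_energy r v v"
      using sg_graph_energy_nonneg [of r "\<lambda>x. a * u x + (- b) * v x"] unfolding quad by simp
    moreover have "a^2 * sg_graph_energy r u u \<le> a^2 * C" "b^2 * sg_graph_energy r v v \<le> b^2 * D"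
      using C D by (auto intro: mult_left_mono)
    ultimately show ?thesis
      unfolding quad by (simp add: algebra_simps)
  qed
  then show ?thesis
    using assms by (auto simp: sg_dom_energy_iff intro!: continuous_intros)
qed

lemma sg_dom_energy_const: "(\<lambda>x. c) \<in> sg_dom_energy"
  by (auto simp: sg_dom_energy_iff sg_graph_energy_def)

text \<open>Monotonicity in the level gives convergence only on the diagonal; polarisation extends
  it to mixed energies, so that the \<open>lim\<close> in \<open>sg_energy\<close> is a genuine
  limit.\<close>

lemma sg_graph_energy_tendsto:
  assumes "u \<in> sg_dom_energy" "v \<in> sg_dom_energy"
  shows "(\<lambda>r. sg_graph_energy r u v) \<longlonglongrightarrow> sg_energy u v"
proof -
  let ?p = "\<lambda>x. 1 * u x + 1 * v x" and ?m = "\<lambda>x. 1 * u x + (-1) * v x"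
  have "convergent (\<lambda>r. sg_graph_energy r ?p ?p)" "convergent (\<lambda>r. sg_graph_energy r ?m ?m)"
    using sg_dom_energy_linear [OF assms] unfolding sg_dom_energy_def by blast+
  then have "convergent (\<lambda>r. (1/4) * (sg_graph_energy r ?p ?p - sg_graph_energy r ?m ?m))"
    by (intro convergent_mult convergent_diff convergent_const)
  moreover have "(1/4) * (sg_graph_energy r ?p ?p - sg_graph_energy r ?m ?m) = sg_graph_energy r u v" for r
    using sg_graph_energy_commute [of r u ?p] sg_graph_energy_commute [of r v ?p]
      sg_graph_energy_commute [of r u ?m] sg_graph_energy_commute [of r v ?m]
      sg_graph_energy_commute [of r v u]
    unfolding sg_graph_energy_linear by simp
  ultimately have "convergent (\<lambda>r. sg_graph_energy r u v)"
    by simp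
  then show ?thesis
    unfolding sg_energy_def by (simp add: convergent_LIMSEQ_iff)
qed

lemma sg_energy_commute: "sg_energy u v = sg_energy v u"
  unfolding sg_energy_def using sg_graph_energy_commute by presburger

lemma sg_energy_cong:
  assumes "\<And>x. x \<in> SG \<Longrightarrow> u x = u' x" "\<And>x. x \<in> SG \<Longrightarrow> v x = v' x"
  shows "sg_energy u v = sg_energy u' v'"
  using sg_graph_energy_cong [of u u' v v'] assms by (simp add: sg_energy_def)

lemma sg_energy_linear:
  assumes "u \<in> sg_dom_energy" "v \<in> sg_dom_energy" "w \<in> sg_dom_energy"
  shows "sg_energy (\<lambda>x. a * u x + b * v x) w = a * sg_energy u w + b * sg_energy v w"
proof (rule LIMSEQ_unique)
  show "(\<lambda>r. sg_graph_energy r (\<lambda>x. a * u x + b * v x) w) \<longlonglongrightarrow> sg_energy (\<lambda>x. a * u x + b * v x) w"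
    using assms by (intro sg_graph_energy_tendsto sg_dom_energy_linear)
  show "(\<lambda>r. sg_graph_energy r (\<lambda>x. a * u x + b * v x) w) \<longlonglongrightarrow> a * sg_energy u w + b * sg_energy v w"
    unfolding sg_graph_energy_linear
    using assms by (intro tendsto_intros sg_graph_energy_tendsto)
qed

text \<open>The level energies are nonnegative and increase to 0, so all vanish. A vanishing sum of
  squares over the edges makes \<open>u\<close> constant on the vertices, and these are
  dense.\<close>

lemma sg_energy_0_imp_const:
  assumes "u \<in> sg_dom_energy" "sg_energy u u = 0" "x \<in> SG"
  shows "u x = u (sg_vertex 0)"
proof -
  have "sg_graph_energy r u u \<le> 0" for r
    using incseq_le [OF sg_graph_energy_incseq sg_graph_energy_tendsto] assms by metis
  then have zero: "sg_graph_energy r u u = 0" for r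
    using sg_graph_energy_nonneg [of r u] by (metis order.antisym)
  have form_0: "w (sg_vertex i) = w (sg_vertex 0)" if "sg_form w w = 0" "i < 3" for w i
  proof -
    have "(w (sg_vertex 0) - w (sg_vertex 1)) * (w (sg_vertex 0) - w (sg_vertex 1)) = 0"
      "(w (sg_vertex 0) - w (sg_vertex 2)) * (w (sg_vertex 0) - w (sg_vertex 2)) = 0"
      using that(1) unfolding sg_form_def
      by (smt (verit) zero_le_square)+
    then show ?thesis
      using that(2) by (auto simp: less_3_cases)
  qed
  have "\<forall>x\<in>sg_V r. w x = w (sg_vertex 0)" if "\<And>r. sg_graph_energy r w w = 0" for r w
    using that
  proof (induction r arbitrary: w)
    case 0
    have "sg_form w w = 0"
      using 0 [of 0] by (simp add: sg_graph_energy_0)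
    then show ?case
      unfolding sg_V_0 sg_V0_eq using form_0 [of w] by blast
  next
    case (Suc r)
    have *: "sg_graph_energy n (\<lambda>x. w (sg_map i x)) (\<lambda>x. w (sg_map i x)) = 0" if "i < 3" for n i
    proof -
      have "(\<Sum>i<3. sg_graph_energy n (\<lambda>x. w (sg_map i x)) (\<lambda>x. w (sg_map i x))) = 0"
        using Suc.prems [of "Suc n"] by (simp add: sg_graph_energy_Suc)
      then show ?thesis
        using that by (subst (asm) sum_nonneg_eq_0_iff) (auto simp: sg_graph_energy_nonneg)
    qed
    have **: "\<forall>x\<in>sg_V r. w (sg_map i x) = w (sg_map i (sg_vertex 0))" if "i < 3" for i
      by (rule Suc.IH) (use * that in blast)
    have "w (sg_vertex i) = w (sg_vertex 0)" if "i < 3" for i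
      using form_0 [of w i] Suc.prems [of 0] that by (simp add: sg_graph_energy_0)
    \<comment> \<open>The fixed corner q_i of cell i is also an outer vertex; it ties the constant
      on cell i to the common value on V_0.\<close>
    moreover have "w (sg_map i (sg_vertex i)) = w (sg_map i (sg_vertex 0))" if "i < 3" for i
      using form_0 [of "\<lambda>x. w (sg_map i x)" i] * [of i 0] that by (simp add: sg_graph_energy_0)
    ultimately have "w (sg_map i x) = w (sg_vertex 0)" if "i < 3" "x \<in> sg_V r" for i x
      using that ** by (metis sg_map_fixes_vertex)
    then show ?case
      unfolding sg_V_Suc by blast
  qed
  with zero have "\<forall>x\<in>sg_Vstar. u x = u (sg_vertex 0)"
    unfolding sg_Vstar_def by blast
  then show ?thesis
    using continuous_constant_on_closure [of sg_Vstar u "u (sg_vertex 0)" x] assms(1,3)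
      sg_dom_energy_continuous [OF assms(1)] unfolding SG_eq_closure by blast
qed

section \<open>Gluing functions along the level 1 cells\<close>

definition sg_unmap :: "nat \<Rightarrow> plane \<Rightarrow> plane" where
  "sg_unmap i x = 2 *\<^sub>R x - sg_vertex i"

lemma sg_unmap_map [simp]: "sg_unmap i (sg_map i x) = x"
  by (simp add: sg_unmap_def sg_map_alt scaleR_add_right)

text \<open>The cell is read off from the coordinate that is at least 1/2. On \<open>SG\<close> the
  order of the tests matters only at junction points, where \<open>sg_compatible\<close> makes the
  pieces agree.\<close>

definition sg_glue :: "(nat \<Rightarrow> plane \<Rightarrow> real) \<Rightarrow> plane \<Rightarrow> real" where
  "sg_glue g x = (if bary 0 x \<ge> 1/2 then g 0 (sg_unmap 0 x)
     else if bary 1 x \<ge> 1/2 then g 1 (sg_unmap 1 x) else g 2 (sg_unmap 2 x))"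

definition sg_compatible :: "(nat \<Rightarrow> plane \<Rightarrow> real) \<Rightarrow> bool" where
  "sg_compatible g \<longleftrightarrow> (\<forall>i<3. \<forall>j<3. g i (sg_vertex j) = g j (sg_vertex i))"

lemma sg_glue_map [simp]:
  assumes g: "sg_compatible g" and "i < 3" "x \<in> SG"
  shows "sg_glue g (sg_map i x) = g i x"
proof -
  have *: "g j (sg_unmap j (sg_map i x)) = g i x" if "j < 3" "bary j (sg_map i x) \<ge> 1/2" for j
  proof (cases "i = j")
    case False
    then have "bary j x \<ge> 1"
      using that \<open>i < 3\<close> by (simp add: bary_map)
    then have "x = sg_vertex j"
      using that \<open>x \<in> SG\<close> bary_le_1 bary_1_imp_vertex by (metis order.antisym)
    then show ?thesis
      using g that \<open>i < 3\<close> by (simp add: sg_map_vertex_commute [of i] sg_compatible_def)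
  qed auto
  have "bary i (sg_map i x) \<ge> 1/2"
    using assms bary_nonneg [of x i] by (simp add: bary_map)
  then have "bary 2 (sg_map i x) \<ge> 1/2" if "\<not> bary 0 (sg_map i x) \<ge> 1/2" "\<not> bary 1 (sg_map i x) \<ge> 1/2"
    using that \<open>i < 3\<close> by (auto simp: less_3_cases)
  then show ?thesis
    using * unfolding sg_glue_def by auto
qed

lemma continuous_on_sg_glue:
  assumes "sg_compatible g" "\<And>i. i < 3 \<Longrightarrow> continuous_on SG (g i)"
  shows "continuous_on SG (sg_glue g)"
proof -
  have "continuous_on (\<Union>i<3. sg_map i ` SG) (sg_glue g)"
  proof (rule continuous_on_closed_Union)
    fix i :: nat assume "i \<in> {..<3}"
    then have i: "i < 3" by simp
    show "closed (sg_map i ` SG)"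
      by (intro compact_imp_closed compact_continuous_image compact_SG continuous_intros)
    have "continuous_on (sg_map i ` SG) (g i \<circ> sg_unmap i)"
      by (intro continuous_on_compose)
        (simp_all add: image_image assms(2) i, auto simp: sg_unmap_def intro!: continuous_intros)
    then show "continuous_on (sg_map i ` SG) (sg_glue g)"
      by (rule continuous_on_eq) (use assms i in auto)
  qed simp
  then show ?thesis
    using SG_invariant by simp
qed

lemma sg_graph_energy_glue:
  assumes "sg_compatible g"
  shows "sg_graph_energy (Suc r) (sg_glue g) (sg_glue g) = 5/3 * (\<Sum>i<3. sg_graph_energy r (g i) (g i))"
  unfolding sg_graph_energy_Suc using assms
  by (intro arg_cong2 [where f = "(*)"] sum.cong refl sg_graph_energy_cong) auto

lemma sg_glue_in_dom_energy:
  assumes "sg_compatible g" "\<And>i. i < 3 \<Longrightarrow> g i \<in> sg_dom_energy"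
  shows "sg_glue g \<in> sg_dom_energy"
proof -
  have "convergent (\<lambda>r. 5/3 * (\<Sum>i<3. sg_graph_energy r (g i) (g i)))"
    using assms(2) unfolding sum_less_3 sg_dom_energy_def
    by (intro convergent_mult convergent_add convergent_const) auto
  then have "convergent (\<lambda>r. sg_graph_energy (Suc r) (sg_glue g) (sg_glue g))"
    unfolding sg_graph_energy_glue [OF assms(1)] .
  then have "convergent (\<lambda>r. sg_graph_energy r (sg_glue g) (sg_glue g))"
    by (rule convergent_Suc_iff [THEN iffD1])
  then show ?thesis
    using continuous_on_sg_glue assms by (simp add: sg_dom_energy_def)
qed

text \<open>The values at the vertices of the \<open>i\<close>-th cell that minimise the energy for the boundary
  values \<open>v\<close>; \<open>3 - i - j\<close> is the index of the third vertex.\<close>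

definition hext :: "nat \<Rightarrow> (nat \<Rightarrow> real) \<Rightarrow> nat \<Rightarrow> real" where
  "hext i v j = (if i = j then v i else (2 * v i + 2 * v j + v (3 - i - j)) / 5)"

section \<open>Harmonic functions as limits of the subdivision rule\<close>

lemma hext_commute: "hext i v j = hext j v i"
  by (simp add: hext_def add.commute diff_commute)

text \<open>The subdivision rule is applied n times, and the corner values of every n-cell are then
  interpolated affinely.\<close>

primrec hseq :: "nat \<Rightarrow> (nat \<Rightarrow> real) \<Rightarrow> plane \<Rightarrow> real" where
  "hseq 0 v x = (\<Sum>i<3. v i * bary i x)"
| "hseq (Suc n) v x = sg_glue (\<lambda>i. hseq n (hext i v)) x"

text \<open>Both claims need one induction: compatibility at step n follows from the vertex values
  at step n, while the vertex values at step \<open>Suc n\<close> are computed through a gluing that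
  needs compatibility.\<close>

lemma hseq_vertex_aux:
  "(\<forall>v. \<forall>j<3. hseq n v (sg_vertex j) = v j) \<and> (\<forall>v. sg_compatible (\<lambda>i. hseq n (hext i v)))"
proof (induction n)
  case 0
  have "hseq 0 v (sg_vertex j) = v j" if "j < 3" for v j
    using that by (auto simp: less_3_cases sum_less_3 bary_vertex)
  then show ?case
    by (simp add: sg_compatible_def hext_commute del: hseq.simps)
next
  case (Suc n)
  have "hseq (Suc n) v (sg_vertex j) = v j" if "j < 3" for v j
  proof -
    have "hseq (Suc n) v (sg_map j (sg_vertex j)) = hseq n (hext j v) (sg_vertex j)"
      using Suc that by (auto simp del: sg_map_fixes_vertex)
    also have "\<dots> = v j"
      using Suc that by (simp add: hext_def)
    finally show ?thesis by simp
  qed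
  then show ?case
    by (simp add: sg_compatible_def hext_commute del: hseq.simps)
qed

lemma hseq_vertex: "j < 3 \<Longrightarrow> hseq n v (sg_vertex j) = v j"
  and hseq_compatible: "sg_compatible (\<lambda>i. hseq n (hext i v))"
  using hseq_vertex_aux by auto

lemma hseq_Suc_map: "i < 3 \<Longrightarrow> x \<in> SG \<Longrightarrow> hseq (Suc n) v (sg_map i x) = hseq n (hext i v) x"
  by (simp add: hseq_compatible)

lemma continuous_on_hseq: "continuous_on SG (hseq n v)"
proof (induction n arbitrary: v)
  case 0
  have "continuous_on SG (\<lambda>x. \<Sum>i<3. v i * bary i x)"
    by (intro continuous_intros)
  then show ?case by simp
next
  case (Suc n)
  have "continuous_on SG (sg_glue (\<lambda>i. hseq n (hext i v)))"
    by (intro continuous_on_sg_glue hseq_compatible Suc)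
  then show ?case by simp
qed

lemma hseq_nonneg:
  assumes "\<And>i. i < 3 \<Longrightarrow> v i \<ge> 0" "x \<in> SG"
  shows "hseq n v x \<ge> 0"
  using assms
proof (induction n arbitrary: v x)
  case 0
  then show ?case
    by (auto intro!: sum_nonneg mult_nonneg_nonneg bary_nonneg)
next
  case (Suc n)
  obtain i y where y: "i < 3" "y \<in> SG" "x = sg_map i y"
    using Suc.prems SG_cases by metis
  have "hext i v j \<ge> 0" if "j < 3" for j
    using Suc.prems(1) [of i] Suc.prems(1) [of j] Suc.prems(1) [of "3 - i - j"] that y(1)
    by (auto simp: hext_def)
  then show ?case
    using y Suc.IH by (simp add: hseq_Suc_map del: hseq.simps)
qed

definition hosc :: "(nat \<Rightarrow> real) \<Rightarrow> real" where
  "hosc v = \<bar>v 0 - v 1\<bar> + \<bar>v 1 - v 2\<bar> + \<bar>v 0 - v 2\<bar>"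

lemma hosc_nonneg: "hosc v \<ge> 0"
  by (simp add: hosc_def)

text \<open>On a subcell the two differences at the retained corner combine old differences with
  weights 2/5 and 1/5, and the third is 1/5 of the opposite one. No old difference enters with total
  weight above 3/5.\<close>

lemma hosc_hext: "i < 3 \<Longrightarrow> hosc (hext i v) \<le> 3/5 * hosc v"
  unfolding less_3_cases by (elim disjE; simp add: hosc_def hext_def; argo?)

lemma hseq_0_bound:
  assumes "x \<in> SG" "j < 3" shows "\<bar>hseq 0 v x - v j\<bar> \<le> hosc v"
proof -
  have b: "bary 0 x \<ge> 0" "bary 1 x \<ge> 0" "bary 2 x \<ge> 0" "bary 0 x \<le> 1" "bary 1 x \<le> 1" "bary 2 x \<le> 1"
    using assms(1) bary_nonneg bary_le_1 by auto
  have "hseq 0 v x - v j = (\<Sum>i<3. v i * bary i x) - v j * (\<Sum>i<3. bary i x)"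
    using bary_sum [of x] by (simp add: sum_less_3)
  also have "\<dots> = (\<Sum>i<3. (v i - v j) * bary i x)"
    by (simp add: sum_distrib_left sum_subtractf algebra_simps)
  also have "\<bar>\<dots>\<bar> \<le> (\<Sum>i<3. \<bar>(v i - v j) * bary i x\<bar>)"
    by (rule sum_abs)
  also have "\<dots> \<le> (\<Sum>i<3. \<bar>v i - v j\<bar>)"
    using bary_nonneg [OF assms(1)] bary_le_1 [OF assms(1)]
    by (intro sum_mono) (auto simp: abs_mult intro!: mult_right_le_one_le)
  also have "\<dots> \<le> hosc v"
    using assms(2) by (auto simp: less_3_cases sum_less_3 hosc_def)
  finally show ?thesis .
qed

text \<open>On cell i both approximations stay within \<open>hosc v\<close> of the corner value
  \<open>v i\<close>, which starts the induction with room to spare. Each further level passes to a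
  subcell and gains a factor 3/5.\<close>

lemma hseq_step_bound:
  assumes "x \<in> SG" shows "\<bar>hseq (Suc n) v x - hseq n v x\<bar> \<le> 3 * hosc v * (3/5) ^ n"
  using assms
proof (induction n arbitrary: v x)
  case 0
  obtain i y where y: "i < 3" "y \<in> SG" "x = sg_map i y"
    using 0 SG_cases by metis
  have "hseq (Suc 0) v x = hseq 0 (hext i v) y"
    using y by (simp add: hseq_Suc_map del: hseq.simps)
  moreover have "\<bar>hseq 0 (hext i v) y - v i\<bar> \<le> hosc (hext i v)"
    using hseq_0_bound [OF y(2,1), of "hext i v"] by (simp add: hext_def)
  moreover have "hosc (hext i v) \<le> hosc v"
    using hosc_hext [OF y(1), of v] hosc_nonneg [of v] by linarith
  moreover have "\<bar>hseq 0 v x - v i\<bar> \<le> hosc v"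
    using hseq_0_bound [OF 0 y(1)] .
  moreover have "hosc v \<ge> 0"
    by (rule hosc_nonneg)
  ultimately show ?case
    by simp
next
  case (Suc n)
  obtain i y where y: "i < 3" "y \<in> SG" "x = sg_map i y"
    using Suc.prems SG_cases by metis
  have "\<bar>hseq (Suc (Suc n)) v x - hseq (Suc n) v x\<bar> = \<bar>hseq (Suc n) (hext i v) y - hseq n (hext i v) y\<bar>"
    using y by (simp only: hseq_Suc_map)
  also have "\<dots> \<le> 3 * hosc (hext i v) * (3/5) ^ n"
    using Suc.IH y(2) .
  also have "\<dots> \<le> 3 * (3/5 * hosc v) * (3/5) ^ n"
    by (intro mult_right_mono mult_left_mono hosc_hext y) auto
  finally show ?case by simp
qed

definition hfun :: "(nat \<Rightarrow> real) \<Rightarrow> plane \<Rightarrow> real" where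
  "hfun v x = lim (\<lambda>n. hseq n v x)"

lemma hfun_uniform_limit: "uniform_limit SG (\<lambda>n. hseq n v) (hfun v) sequentially"
proof -
  have tele: "(\<Sum>i<n. hseq (Suc i) v x - hseq i v x) = hseq n v x - hseq 0 v x" for n x
    by (rule sum_lessThan_telescope)
  define M where "M = (\<lambda>n. 3 * hosc v * (3/5) ^ n)"
  have "summable M"
    unfolding M_def by (intro summable_mult summable_geometric) simp
  then have "uniform_limit SG (\<lambda>n x. \<Sum>i<n. hseq (Suc i) v x - hseq i v x)
      (\<lambda>x. \<Sum>i. hseq (Suc i) v x - hseq i v x) sequentially"
    using hseq_step_bound by (intro Weierstrass_m_test [of _ _ M]) (auto simp: M_def)
  then have *: "uniform_limit SG (\<lambda>n x. hseq n v x - hseq 0 v x)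
      (\<lambda>x. \<Sum>i. hseq (Suc i) v x - hseq i v x) sequentially"
    unfolding tele .
  have "uniform_limit SG (\<lambda>n x. (hseq n v x - hseq 0 v x) + hseq 0 v x)
      (\<lambda>x. (\<Sum>i. hseq (Suc i) v x - hseq i v x) + hseq 0 v x) sequentially"
    by (intro uniform_limit_add * uniform_limit_const)
  then have **: "uniform_limit SG (\<lambda>n x. hseq n v x)
      (\<lambda>x. (\<Sum>i. hseq (Suc i) v x - hseq i v x) + hseq 0 v x) sequentially"
    by simp
  have "(\<Sum>i. hseq (Suc i) v x - hseq i v x) + hseq 0 v x = hfun v x" if "x \<in> SG" for x
    using tendsto_uniform_limitI [OF ** that] by (simp add: hfun_def limI)
  then show ?thesis
    using ** by (subst (asm) uniform_limit_cong' [OF refl])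
qed

lemma hfun_tendsto: "x \<in> SG \<Longrightarrow> (\<lambda>n. hseq n v x) \<longlonglongrightarrow> hfun v x"
  using tendsto_uniform_limitI [OF hfun_uniform_limit] .

lemma continuous_on_hfun: "continuous_on SG (hfun v)"
  by (rule uniform_limit_theorem [OF _ hfun_uniform_limit]) (auto simp: continuous_on_hseq)

lemma hfun_vertex: "j < 3 \<Longrightarrow> hfun v (sg_vertex j) = v j"
  using LIMSEQ_unique [OF hfun_tendsto [of "sg_vertex j" v]] by (simp add: hseq_vertex)

lemma hfun_map:
  assumes "i < 3" "x \<in> SG" shows "hfun v (sg_map i x) = hfun (hext i v) x"
proof (rule LIMSEQ_unique)
  show "(\<lambda>n. hseq (Suc n) v (sg_map i x)) \<longlonglongrightarrow> hfun v (sg_map i x)"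
    using assms by (intro LIMSEQ_Suc hfun_tendsto) blast
  show "(\<lambda>n. hseq (Suc n) v (sg_map i x)) \<longlonglongrightarrow> hfun (hext i v) x"
    unfolding hseq_Suc_map [OF assms] using assms by (intro hfun_tendsto)
qed

lemma hfun_nonneg: "(\<And>i. i < 3 \<Longrightarrow> v i \<ge> 0) \<Longrightarrow> x \<in> SG \<Longrightarrow> hfun v x \<ge> 0"
  using LIMSEQ_le_const [OF hfun_tendsto [of x v], of 0] hseq_nonneg by blast

text \<open>Every remainder term in \<open>sg_form_subdivide\<close> carries a deviation of the
  first argument, and those of \<open>hfun v\<close> vanish by construction. That \<open>w\<close>
  is arbitrary makes this the weak form of harmonicity.\<close>

lemma sg_graph_energy_hfun: "sg_graph_energy r (hfun v) w = sg_form (hfun v) w"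
proof (induction r arbitrary: v w)
  case 0
  show ?case by (rule sg_graph_energy_0)
next
  case (Suc r)
  have "sg_graph_energy r (\<lambda>x. hfun v (sg_map i x)) (\<lambda>x. w (sg_map i x)) =
      sg_form (\<lambda>x. hfun v (sg_map i x)) (\<lambda>x. w (sg_map i x))" if "i < 3" for i
  proof -
    have "sg_graph_energy r (\<lambda>x. hfun v (sg_map i x)) (\<lambda>x. w (sg_map i x)) =
      sg_graph_energy r (hfun (hext i v)) (\<lambda>x. w (sg_map i x))"
      using that by (intro sg_graph_energy_cong) (auto simp: hfun_map)
    also have "\<dots> = sg_form (hfun (hext i v)) (\<lambda>x. w (sg_map i x))"
      by (rule Suc)
    also have "\<dots> = sg_form (\<lambda>x. hfun v (sg_map i x)) (\<lambda>x. w (sg_map i x))"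
      using that by (simp add: sg_form_def hfun_map)
    finally show ?thesis .
  qed
  then have "sg_graph_energy (Suc r) (hfun v) w =
      5/3 * (\<Sum>i<3. sg_form (\<lambda>x. hfun v (sg_map i x)) (\<lambda>x. w (sg_map i x)))"
    unfolding sg_graph_energy_Suc by simp
  also have "\<dots> = sg_form (hfun v) w"
    unfolding sg_form_subdivide by (simp add: hfun_map hfun_vertex hext_def)
  finally show ?case .
qed

lemma hfun_in_dom_energy: "hfun v \<in> sg_dom_energy"
  by (simp add: sg_dom_energy_def continuous_on_hfun sg_graph_energy_hfun convergent_const)

lemma sg_energy_hfun: "sg_energy (hfun v) w = sg_form (hfun v) w"
  by (simp add: sg_energy_def sg_graph_energy_hfun)

section \<open>Localised test functions\<close>

definition sg_bump :: "plane \<Rightarrow> real" where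
  "sg_bump = sg_glue (\<lambda>i. hfun (\<lambda>j. of_bool (i \<noteq> j)))"

text \<open>Both pieces equal 1 at a junction. Each piece is 0 at its outer corner, so the bump
  vanishes on V_0 as a test function must.\<close>

lemma sg_bump_compatible: "sg_compatible (\<lambda>i. hfun (\<lambda>j. of_bool (i \<noteq> j)))"
  by (simp add: sg_compatible_def hfun_vertex eq_commute)

lemma sg_bump_in_dom_energy: "sg_bump \<in> sg_dom_energy"
  unfolding sg_bump_def by (intro sg_glue_in_dom_energy sg_bump_compatible hfun_in_dom_energy)

lemma sg_bump_map: "i < 3 \<Longrightarrow> x \<in> SG \<Longrightarrow> sg_bump (sg_map i x) = hfun (\<lambda>j. of_bool (i \<noteq> j)) x"
  unfolding sg_bump_def by (simp add: sg_bump_compatible)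

lemma sg_bump_V0: "x \<in> sg_V0 \<Longrightarrow> sg_bump x = 0"
proof -
  assume "x \<in> sg_V0"
  then obtain i where i: "i < 3" "x = sg_vertex i"
    unfolding sg_V0_eq by blast
  then show ?thesis
    using sg_bump_map [of i "sg_vertex i"] by (simp add: hfun_vertex)
qed

lemma sg_bump_nonneg: "x \<in> SG \<Longrightarrow> sg_bump x \<ge> 0"
proof -
  assume "x \<in> SG"
  then obtain i y where i: "i < 3" "y \<in> SG" "x = sg_map i y"
    by (rule SG_cases)
  then show ?thesis
    unfolding i(3) sg_bump_map [OF i(1,2)] by (intro hfun_nonneg) simp_all
qed

lemma sg_bump_midpoint: "sg_bump (sg_map 0 (sg_vertex 1)) = 1"
  by (subst sg_bump_map) (simp_all add: hfun_vertex)

text \<open>Transplants \<open>f\<close> into the cell of the word and puts 0 elsewhere. For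
  \<open>f\<close> vanishing on V_0 the pieces agree at all junctions, so finite energy is
  preserved.\<close>

primrec sg_cell_extend :: "nat list \<Rightarrow> (plane \<Rightarrow> real) \<Rightarrow> plane \<Rightarrow> real" where
  "sg_cell_extend [] f = f"
| "sg_cell_extend (i # w) f = sg_glue (\<lambda>j. if j = i then sg_cell_extend w f else (\<lambda>x. 0))"

lemma sg_cell_extend:
  assumes "f \<in> sg_dom_energy" "\<And>x. x \<in> sg_V0 \<Longrightarrow> f x = 0" "set w \<subseteq> {..<3}"
  shows "sg_cell_extend w f \<in> sg_dom_energy \<and> (\<forall>x\<in>sg_V0. sg_cell_extend w f x = 0) \<and>
    (\<forall>x\<in>SG. sg_cell_extend w f (sg_word_map w x) = f x) \<and>
    (\<forall>y\<in>SG - sg_word_map w ` SG. sg_cell_extend w f y = 0)"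
  using assms(3)
proof (induction w)
  case Nil
  then show ?case using assms(1,2) by simp
next
  case (Cons i w)
  let ?g = "\<lambda>j. if j = i then sg_cell_extend w f else (\<lambda>x. 0)"
  from Cons have i: "i < 3" and
    IH: "sg_cell_extend w f \<in> sg_dom_energy" "\<And>x. x \<in> sg_V0 \<Longrightarrow> sg_cell_extend w f x = 0"
    "\<And>x. x \<in> SG \<Longrightarrow> sg_cell_extend w f (sg_word_map w x) = f x"
    "\<And>y. y \<in> SG - sg_word_map w ` SG \<Longrightarrow> sg_cell_extend w f y = 0"
    by auto
  have zero: "?g j x = 0" if "x \<in> sg_V0" for j x
    using IH(2) that by simp
  have comp: "sg_compatible ?g"
    unfolding sg_compatible_def using zero by (auto simp: sg_V0_eq)
  have "sg_glue ?g \<in> sg_dom_energy"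
    using comp IH(1) sg_dom_energy_const [of 0] by (intro sg_glue_in_dom_energy) auto
  moreover have "sg_glue ?g x = 0" if "x \<in> sg_V0" for x
  proof -
    obtain j where j: "j < 3" "x = sg_map j (sg_vertex j)"
      using \<open>x \<in> sg_V0\<close> by (auto simp: sg_V0_eq)
    then show ?thesis
      unfolding j(2) using zero [of "sg_vertex j" j]
      by (subst sg_glue_map [OF comp]) (auto simp: sg_V0_eq)
  qed
  moreover have "sg_glue ?g (sg_word_map (i # w) x) = f x" if "x \<in> SG" for x
    using that i comp IH(3) by (simp add: sg_word_map_in_SG)
  moreover have "sg_glue ?g y = 0" if y: "y \<in> SG - sg_word_map (i # w) ` SG" for y
  proof -
    obtain j z where z: "j < 3" "z \<in> SG" "y = sg_map j z"
      using y SG_cases by (metis DiffD1)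
    have "z \<notin> sg_word_map w ` SG" if "j = i"
      using y z that by (auto simp: image_iff)
    then show ?thesis
      using z comp IH(4) by auto
  qed
  ultimately show ?case by simp
qed

section \<open>The self-similar measure\<close>

lemma sg_map_unmap [simp]: "sg_map i (sg_unmap i x) = x"
  by (simp add: sg_unmap_def sg_map_alt scaleR_diff_right)

lemma borel_measurable_sg_map [measurable]: "sg_map i \<in> borel_measurable borel"
  by (intro borel_measurable_continuous_onI continuous_intros)

lemma SG_borel [measurable]: "SG \<in> sets borel"
  by (simp add: closed_SG)

lemma sg_cell_Nil [simp]: "sg_cell [] = SG"
  by (simp add: sg_cell_def)

lemma sg_cell_Cons: "sg_cell (i # w) = sg_map i ` sg_cell w"
  by (simp add: sg_cell_def image_image)

lemma compact_sg_cell: "compact (sg_cell w)"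
proof (induction w)
  case (Cons i w)
  then show ?case
    unfolding sg_cell_Cons by (intro compact_continuous_image continuous_intros)
qed (simp add: compact_SG)

lemma sg_cell_borel [measurable]: "sg_cell w \<in> sets borel"
  by (simp add: compact_imp_closed compact_sg_cell)

lemma sg_cell_subset_SG: "sg_cell w \<subseteq> SG"
  by (auto simp: sg_cell_def)

section \<open>Uniqueness of the self-similar measure\<close>

definition sg_selfsimilar :: "plane measure \<Rightarrow> bool" where
  "sg_selfsimilar M \<longleftrightarrow> prob_space M \<and> sets M = sets borel \<and>
     (\<forall>A\<in>sets borel. measure M A = (\<Sum>i<3. measure M (sg_map i -` A)) / 3)"

lemma sg_selfsimilarD:
  assumes "sg_selfsimilar M"
  shows "prob_space M" "sets M = sets borel" "space M = UNIV"
    "A \<in> sets borel \<Longrightarrow> measure M A = (\<Sum>i<3. measure M (sg_map i -` A)) / 3"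
  using assms sets_eq_imp_space_eq [of M borel] by (auto simp: sg_selfsimilar_def)

lemma sg_map_vimage_borel: "A \<in> sets borel \<Longrightarrow> sg_map i -` A \<in> sets borel"
  using measurable_sets [OF borel_measurable_sg_map, of A i] by simp

text \<open>Pulling \<open>A\<close> back along the three maps doubles distances, and
  self-similarity averages the three inequalities. At r = 0 either \<open>A\<close> misses the
  gasket and has mass 0, or the thickening contains the whole gasket, whose diameter is at most
  2.\<close>

lemma sg_selfsimilar_le_thickening:
  assumes M: "sg_selfsimilar M" "measure M SG = 1" and N: "sg_selfsimilar N" "measure N SG = 1"
    and A: "closed A" "A \<noteq> {}"
  shows "measure M A \<le> measure N {x. infdist x A \<le> 2 / 2 ^ r}"
  using A
proof (induction r arbitrary: A)
  case 0
  interpret M: prob_space M using sg_selfsimilarD [OF M(1)] by simp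
  interpret N: prob_space N using sg_selfsimilarD [OF N(1)] by simp
  note [simp] = sg_selfsimilarD(2,3) [OF M(1)] sg_selfsimilarD(2,3) [OF N(1)]
  show ?case
  proof (cases "A \<inter> SG = {}")
    case True
    have "measure M A \<le> measure M (UNIV - SG)"
      using True 0 by (intro M.finite_measure_mono) (auto simp: borel_closed)
    also have "\<dots> = 0"
      using M.prob_compl [of SG] M(2) SG_borel by simp
    finally show ?thesis
      using measure_nonneg order.trans by blast
  next
    case False
    then obtain a where "a \<in> A" "a \<in> SG" by blast
    have "infdist x A \<le> 2" if "x \<in> SG" for x
      using infdist_le [OF \<open>a \<in> A\<close>, of x] dist_SG_le [OF that \<open>a \<in> SG\<close>] by simp
    then have "SG \<subseteq> {x. infdist x A \<le> 2 / 2 ^ 0}"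
      by (simp add: subset_iff)
    moreover have "closed {x. infdist x A \<le> 2 / 2 ^ 0}"
      by (intro closed_Collect_le continuous_intros)
    ultimately have "measure N SG \<le> measure N {x. infdist x A \<le> 2 / 2 ^ 0}"
      by (intro N.finite_measure_mono) (auto simp: borel_closed)
    then show ?thesis
      using N(2) M.prob_le_1 [of A] by linarith
  qed
next
  case (Suc r)
  interpret N: prob_space N using sg_selfsimilarD [OF N(1)] by simp
  note [simp] = sg_selfsimilarD(2,3) [OF M(1)] sg_selfsimilarD(2,3) [OF N(1)]
  define T where "T = {x. infdist x A \<le> 2 / 2 ^ Suc r}"
  have T: "closed T"
    unfolding T_def by (intro closed_Collect_le continuous_intros)
  have "measure M (sg_map i -` A) \<le> measure N (sg_map i -` T)" for i
  proof -
    have B: "closed (sg_map i -` A)"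
      using Suc.prems by (intro closed_vimage continuous_intros)
    obtain a where "a \<in> A" using Suc.prems by blast
    then have "sg_unmap i a \<in> sg_map i -` A"
      by simp
    then have ne: "sg_map i -` A \<noteq> {}"
      by blast
    have "measure M (sg_map i -` A) \<le> measure N {x. infdist x (sg_map i -` A) \<le> 2 / 2 ^ r}"
      by (rule Suc.IH [OF B ne])
    also have "{x. infdist x (sg_map i -` A) \<le> 2 / 2 ^ r} \<subseteq> sg_map i -` T"
    proof (rule subsetI)
      fix x assume x: "x \<in> {x. infdist x (sg_map i -` A) \<le> 2 / 2 ^ r}"
      obtain b where b: "b \<in> sg_map i -` A" "infdist x (sg_map i -` A) = dist x b"
        using infdist_attains_inf [OF B ne] by metis
      then have "infdist (sg_map i x) A \<le> dist (sg_map i x) (sg_map i b)"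
        by (intro infdist_le) simp
      with b x show "x \<in> sg_map i -` T"
        by (simp add: T_def)
    qed
    then have "measure N {x. infdist x (sg_map i -` A) \<le> 2 / 2 ^ r} \<le> measure N (sg_map i -` T)"
      using T by (intro N.finite_measure_mono) (simp_all add: sg_map_vimage_borel borel_closed)
    finally show ?thesis .
  qed
  then have "(\<Sum>i<3. measure M (sg_map i -` A)) / 3 \<le> (\<Sum>i<3. measure N (sg_map i -` T)) / 3"
    by (intro divide_right_mono sum_mono) auto
  then show ?case
    using sg_selfsimilarD(4) [OF M(1), of A] sg_selfsimilarD(4) [OF N(1), of T] T Suc.prems
    unfolding T_def [symmetric] by (simp add: borel_closed)
qed

lemma sg_selfsimilar_le:
  assumes M: "sg_selfsimilar M" "measure M SG = 1" and N: "sg_selfsimilar N" "measure N SG = 1"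
    and A: "closed A"
  shows "measure M A \<le> measure N A"
proof (cases "A = {}")
  case False
  interpret N: prob_space N using sg_selfsimilarD [OF N(1)] by simp
  note [simp] = sg_selfsimilarD(2,3) [OF N(1)]
  define T where "T = (\<lambda>r. {x. infdist x A \<le> 2 / 2 ^ r})"
  have lim: "(\<lambda>r. 2 / 2 ^ r :: real) \<longlonglongrightarrow> 0"
    by (rule LIMSEQ_divide_realpow_zero) simp
  have "(\<Inter>r. T r) = A"
  proof
    show "(\<Inter>r. T r) \<subseteq> A"
    proof
      fix x assume "x \<in> (\<Inter>r. T r)"
      then have "infdist x A \<le> 0"
        using LIMSEQ_le_const [OF lim, of "infdist x A"] by (auto simp: T_def)
      then show "x \<in> A"
        using in_closed_iff_infdist_zero [OF A False] infdist_nonneg [of x A] by simp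
    qed
  qed (auto simp: T_def)
  moreover have "decseq T"
    unfolding T_def by (intro decseq_SucI) (auto intro: order.trans simp: field_simps)
  moreover have "closed (T r)" for r
    unfolding T_def by (intro closed_Collect_le continuous_intros)
  ultimately have "(\<lambda>r. measure N (T r)) \<longlonglongrightarrow> measure N A"
    using N.finite_Lim_measure_decseq [of T] by (simp add: borel_closed image_subset_iff)
  then show ?thesis
    using sg_selfsimilar_le_thickening [OF M N A False] unfolding T_def
    by (intro LIMSEQ_le_const) auto
qed simp

lemma sg_selfsimilar_unique:
  assumes M: "sg_selfsimilar M" "measure M SG = 1" and N: "sg_selfsimilar N" "measure N SG = 1"
  shows "M = N"
proof (rule measure_eqI_generator_eq)
  interpret M: prob_space M using sg_selfsimilarD [OF M(1)] by simp
  interpret N: prob_space N using sg_selfsimilarD [OF N(1)] by simp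
  show "Int_stable (Collect closed :: plane set set)"
    by (auto simp: Int_stable_def)
  show "emeasure M X = emeasure N X" if "X \<in> Collect closed" for X
    using sg_selfsimilar_le [OF M N, of X] sg_selfsimilar_le [OF N M, of X] that
    by (simp add: M.emeasure_eq_measure N.emeasure_eq_measure)
  have "sets borel = sigma_sets UNIV (Collect closed :: plane set set)"
    by (simp add: borel_eq_closed)
  then show "sets M = sigma_sets UNIV (Collect closed)" "sets N = sigma_sets UNIV (Collect closed)"
    using sg_selfsimilarD(2) [OF M(1)] sg_selfsimilarD(2) [OF N(1)] by simp_all
  show "range (\<lambda>i::nat. UNIV :: plane set) \<subseteq> Collect closed" by auto
  show "(\<Union>i::nat. UNIV :: plane set) = UNIV" by simp
qed (simp_all add: sg_selfsimilarD(1) [OF M(1), THEN prob_space.finite_measure, THEN finite_measure.emeasure_finite])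

section \<open>Existence of the measure through the address map of digit streams\<close>

definition sg_code :: "nat stream \<Rightarrow> plane" where
  "sg_code \<omega> = (\<Sum>n. (1/2) ^ Suc n *\<^sub>R sg_vertex (\<omega> !! n))"

lemma summable_sg_code: "summable (\<lambda>n. (1/2) ^ Suc n *\<^sub>R sg_vertex (\<omega> !! n))"
proof (rule summable_comparison_test')
  show "summable (\<lambda>n. (1/2) ^ n :: real)"
    by (rule summable_geometric) simp
  show "norm ((1/2) ^ Suc n *\<^sub>R sg_vertex (\<omega> !! n)) \<le> (1/2) ^ n" for n
    using mult_mono [of "(1/2) ^ Suc n" "(1/2) ^ n" "norm (sg_vertex (\<omega> !! n))" "1::real"]
      norm_sg_vertex_le [of "\<omega> !! n"] by (simp add: abs_mult)
qed

lemma sg_code_Stream: "sg_code (i ## \<omega>) = sg_map i (sg_code \<omega>)"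
proof -
  have "sg_code (i ## \<omega>) = (1/2) *\<^sub>R sg_vertex i +
      (\<Sum>n. (1/2) *\<^sub>R ((1/2) ^ Suc n *\<^sub>R sg_vertex (\<omega> !! n)))"
    unfolding sg_code_def using suminf_split_head [OF summable_sg_code, of "i ## \<omega>"]
    by (simp add: algebra_simps)
  also have "(\<Sum>n. (1/2) *\<^sub>R ((1/2) ^ Suc n *\<^sub>R sg_vertex (\<omega> !! n))) = (1/2) *\<^sub>R sg_code \<omega>"
    unfolding sg_code_def by (rule suminf_scaleR_right [OF summable_sg_code, symmetric])
  finally show ?thesis
    by (simp add: sg_map_alt add.commute)
qed

lemma sg_code_in_SG: "sg_code \<omega> \<in> SG"
proof -
  \<comment> \<open>\<open>g n\<close> is the image of q_0 under the maps of the first n digits; the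
    extra multiple of q_0 turns the partial sum into a point of the gasket and tends to 0.\<close>
  define g where "g = (\<lambda>n \<omega>. (\<Sum>k<n. (1/2) ^ Suc k *\<^sub>R sg_vertex (\<omega> !! k)) + (1/2) ^ n *\<^sub>R sg_vertex 0)"
  have "g n \<omega> \<in> SG" for n \<omega>
  proof (induction n arbitrary: \<omega>)
    case 0
    then show ?case by (simp add: g_def)
  next
    case (Suc n)
    have "g (Suc n) \<omega> = sg_map (shd \<omega>) (g n (stl \<omega>))"
      by (simp add: g_def sum.lessThan_Suc_shift sg_map_alt scaleR_add_right scaleR_sum_right
          add_ac del: sum.lessThan_Suc)
    then show ?case
      using Suc by auto
  qed
  moreover have "(\<lambda>n. g n \<omega>) \<longlonglongrightarrow> sg_code \<omega> + 0 *\<^sub>R sg_vertex 0"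
    unfolding g_def sg_code_def
    by (intro tendsto_intros summable_LIMSEQ summable_sg_code LIMSEQ_power_zero) auto
  ultimately show ?thesis
    using closed_sequentially [OF closed_SG, of "\<lambda>n. g n \<omega>"] by simp
qed

definition sg_digits :: "nat stream measure" where
  "sg_digits = stream_space (measure_pmf (pmf_of_set {..<3}))"

lemma prob_space_sg_digits: "prob_space sg_digits"
  unfolding sg_digits_def by (intro prob_space.prob_space_stream_space measure_pmf.prob_space_axioms)

lemma space_sg_digits [simp]: "space sg_digits = UNIV"
  by (simp add: sg_digits_def space_stream_space)

lemma sg_code_measurable [measurable]: "sg_code \<in> borel_measurable sg_digits"
proof -
  have "(\<lambda>\<omega>. sg_vertex (\<omega> !! n)) \<in> borel_measurable sg_digits" for n
    unfolding sg_digits_def by (rule measurable_compose [OF measurable_snth]) simp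
  then have "(\<lambda>\<omega>. \<Sum>n. (1/2) ^ Suc n *\<^sub>R sg_vertex (\<omega> !! n)) \<in> borel_measurable sg_digits"
    by (intro borel_measurable_suminf borel_measurable_scaleR borel_measurable_const)
  then show ?thesis
    by (simp add: sg_code_def [abs_def])
qed

lemma measure_sg_digits_Stream:
  assumes "X \<in> sets sg_digits"
  shows "measure sg_digits X = (\<Sum>i<3. measure sg_digits {\<omega>. i ## \<omega> \<in> X}) / 3"
proof -
  interpret D: prob_space sg_digits by (rule prob_space_sg_digits)
  have ne: "{..<3::nat} \<noteq> {}" unfolding lessThan_3 by blast
  have "ennreal (measure sg_digits X) = emeasure sg_digits X"
    by (simp add: D.emeasure_eq_measure)
  also have "\<dots> = (\<integral>\<^sup>+t. emeasure sg_digits {\<omega>. t ## \<omega> \<in> X} \<partial>measure_pmf (pmf_of_set {..<3}))"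
    using prob_space.emeasure_stream_space [OF measure_pmf.prob_space_axioms, of X "pmf_of_set {..<3}"] assms
    unfolding sg_digits_def [symmetric] by simp
  also have "\<dots> = (\<Sum>i<3. ennreal (measure sg_digits {\<omega>. i ## \<omega> \<in> X})) / 3"
    using ne by (subst nn_integral_pmf_of_set) (simp_all add: D.emeasure_eq_measure)
  also have "\<dots> = ennreal ((\<Sum>i<3. measure sg_digits {\<omega>. i ## \<omega> \<in> X}) / 3)"
    by (simp add: divide_ennreal [symmetric] sum_nonneg sum_ennreal)
  finally show ?thesis
    by (subst (asm) ennreal_inj) (auto intro!: sum_nonneg divide_nonneg_nonneg)
qed

text \<open>Condition on the first of the independent uniform digits: prepending i to a stream
  applies \<open>sg_map i\<close> to its code.\<close>

lemma sg_selfsimilar_distr: "sg_selfsimilar (distr sg_digits borel sg_code)"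
  unfolding sg_selfsimilar_def
proof (intro conjI ballI)
  interpret D: prob_space sg_digits by (rule prob_space_sg_digits)
  show "prob_space (distr sg_digits borel sg_code)"
    by (rule D.prob_space_distr) measurable
  fix A :: "plane set" assume A: "A \<in> sets borel"
  then have "sg_code -` A \<in> sets sg_digits"
    using measurable_sets [OF sg_code_measurable, of A] by simp
  then have "measure sg_digits (sg_code -` A) = (\<Sum>i<3. measure sg_digits (sg_code -` (sg_map i -` A))) / 3"
    by (simp add: measure_sg_digits_Stream sg_code_Stream vimage_def)
  then show "measure (distr sg_digits borel sg_code) A =
      (\<Sum>i<3. measure (distr sg_digits borel sg_code) (sg_map i -` A)) / 3"
    using A by (simp add: measure_distr sg_map_vimage_borel)
qed simp

lemma measure_distr_SG: "measure (distr sg_digits borel sg_code) SG = 1"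
proof -
  interpret D: prob_space sg_digits by (rule prob_space_sg_digits)
  have "sg_code -` SG = UNIV"
    using sg_code_in_SG by auto
  then show ?thesis
    using D.prob_space by (simp add: measure_distr)
qed

text \<open>Of the three preimages of a cell, one is the cell of the shortened word and the other
  two meet the gasket in at most one vertex. Vertices are null because self-similarity leaves each
  of them a third of its own mass.\<close>

lemma measure_sg_cell:
  assumes M: "sg_selfsimilar M" "measure M SG = 1" and w: "w \<in> sg_words r"
  shows "measure M (sg_cell w) = 1 / 3 ^ r"
proof -
  interpret M: prob_space M using sg_selfsimilarD [OF M(1)] by simp
  note [simp] = sg_selfsimilarD(2,3) [OF M(1)]
  have null: "measure M A = 0" if "A \<in> sets borel" "A \<inter> SG = {}" for A
  proof -
    have "measure M A \<le> measure M (UNIV - SG)"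
      using that by (intro M.finite_measure_mono) auto
    also have "\<dots> = 0"
      using M.prob_compl [of SG] M(2) SG_borel by simp
    finally show ?thesis
      using measure_nonneg [of M A] by simp
  qed
  have vertex: "measure M {sg_vertex j} = 0" if j: "j < 3" for j
  proof -
    have "measure M (sg_map i -` {sg_vertex j}) = (if i = j then measure M {sg_vertex j} else 0)"
      if i: "i < 3" for i
    proof (cases "i = j")
      case True
      have "sg_map i x = sg_vertex i \<longleftrightarrow> x = sg_vertex i" for x
        by (metis sg_map_fixes_vertex sg_map_inj)
      then have "sg_map i -` {sg_vertex j} = {sg_vertex j}"
        unfolding True by blast
      with True show ?thesis by simp
    next
      case False
      then have "sg_map i -` {sg_vertex j} \<inter> SG = {}"
        using sg_map_eq_vertex i j by blast
      with False show ?thesis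
        by (simp add: null sg_map_vimage_borel)
    qed
    then have "(\<Sum>i<3. measure M (sg_map i -` {sg_vertex j})) = measure M {sg_vertex j}"
      using j by simp
    then show ?thesis
      using sg_selfsimilarD(4) [OF M(1), of "{sg_vertex j}"] by simp
  qed
  show ?thesis
    using w
  proof (induction r arbitrary: w)
    case 0
    then show ?case using M(2) by simp
  next
    case (Suc r)
    then obtain i v where v: "i < 3" "v \<in> sg_words r" "w = i # v"
      by (auto simp: sg_words_Suc)
    have "measure M (sg_map j -` sg_cell w) = (if j = i then 1 / 3 ^ r else 0)" if j: "j < 3" for j
    proof (cases "j = i")
      case True
      have "sg_map j -` sg_cell w = sg_cell v"
        unfolding v sg_cell_Cons True by (intro inj_vimage_image_eq injI) simp
      with True show ?thesis
        using Suc.IH v by simp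
    next
      case False
      let ?A = "sg_map j -` sg_cell w"
      have A: "?A \<in> sets borel"
        by (intro sg_map_vimage_borel) measurable
      have "?A \<inter> SG \<subseteq> {sg_vertex i}"
      proof
        fix x assume x: "x \<in> ?A \<inter> SG"
        then obtain y where "y \<in> sg_cell v" "sg_map j x = sg_map i y"
          unfolding v sg_cell_Cons by auto
        then show "x \<in> {sg_vertex i}"
          using sg_map_eq_sg_map(1) [of x y j i] x v(1) j False sg_cell_subset_SG by blast
      qed
      then have "measure M (?A \<inter> SG) \<le> measure M {sg_vertex i}"
        by (intro M.finite_measure_mono) auto
      moreover have "measure M (?A - SG) = 0"
        using A by (intro null) auto
      moreover have "measure M ?A = measure M (?A \<inter> SG) + measure M (?A - SG)"
        using A by (subst M.finite_measure_Union [symmetric]) (auto intro!: arg_cong [where f = "measure M"])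
      ultimately show ?thesis
        using vertex [OF v(1)] False measure_nonneg [of M "?A \<inter> SG"] by simp
    qed
    then have "(\<Sum>j<3. measure M (sg_map j -` sg_cell w)) = 1 / 3 ^ r"
      using v(1) by simp
    then show ?case
      using sg_selfsimilarD(4) [OF M(1), of "sg_cell w"] by simp
  qed
qed

text \<open>For a self-similar measure the condition on all cells is equivalent to full mass on
  \<open>SG\<close>: the case r = 0 gives one direction, \<open>measure_sg_cell\<close> the other.
  Existence and uniqueness are known for the simpler condition.\<close>

lemma sg_measure_properties: "sg_selfsimilar sg_measure" "measure sg_measure SG = 1"
proof -
  let ?P = "\<lambda>M. prob_space M \<and> sets M = sets borel
     \<and> (\<forall>A\<in>sets borel. measure M A = (\<Sum>i<3. measure M (sg_map i -` A)) / 3)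
     \<and> (\<forall>r. \<forall>w\<in>sg_words r. measure M (sg_cell w) = 1 / 3 ^ r)"
  have iff: "?P M \<longleftrightarrow> sg_selfsimilar M \<and> measure M SG = 1" for M
  proof
    assume P: "?P M"
    then have "\<forall>w\<in>sg_words 0. measure M (sg_cell w) = 1 / 3 ^ 0"
      by blast
    with P show "sg_selfsimilar M \<and> measure M SG = 1"
      by (simp add: sg_selfsimilar_def)
  next
    assume "sg_selfsimilar M \<and> measure M SG = 1"
    then show "?P M"
      using measure_sg_cell by (auto simp: sg_selfsimilar_def)
  qed
  let ?M = "distr sg_digits borel sg_code"
  have M: "sg_selfsimilar ?M" "measure ?M SG = 1"
    by (rule sg_selfsimilar_distr measure_distr_SG)+
  have "sg_measure = ?M"
    unfolding sg_measure_def iff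
  proof (rule the_equality)
    show "sg_selfsimilar ?M \<and> measure ?M SG = 1"
      using M by blast
    show "N = ?M" if "sg_selfsimilar N \<and> measure N SG = 1" for N
      using sg_selfsimilar_unique [OF _ _ M] that by blast
  qed
  with M show "sg_selfsimilar sg_measure" "measure sg_measure SG = 1"
    by simp_all
qed

lemma sets_sg_measure [simp, measurable_cong]: "sets sg_measure = sets borel"
  and space_sg_measure [simp]: "space sg_measure = UNIV"
  and prob_space_sg_measure: "prob_space sg_measure"
  using sg_selfsimilarD [OF sg_measure_properties(1)] by auto

interpretation sg_measure: prob_space sg_measure
  by (rule prob_space_sg_measure)

section \<open>The reflection that fixes the top vertex\<close>

definition sg_flip :: "plane \<Rightarrow> plane" where
  "sg_flip x = (1 - fst x, snd x)"

lemma sg_flip_flip [simp]: "sg_flip (sg_flip x) = x"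
  by (simp add: sg_flip_def)

lemma continuous_on_sg_flip [continuous_intros]: "continuous_on S sg_flip"
  unfolding sg_flip_def by (intro continuous_intros)

lemma borel_measurable_sg_flip [measurable]: "sg_flip \<in> borel_measurable borel"
  by (intro borel_measurable_continuous_onI continuous_intros)

text \<open>The reflection fixes q_0 and swaps q_1 and q_2; on indices modulo 3 this is
  doubling.\<close>

lemma sg_flip_map: "sg_flip (sg_map i x) = sg_map (2 * i) (sg_flip x)"
proof -
  have "(2 * i) mod 3 = (if i mod 3 = 0 then 0 else if i mod 3 = 1 then 2 else 1)"
    by presburger
  then show ?thesis
    by (auto simp: sg_flip_def sg_map_def sg_vertex_def field_simps)
qed

lemma sg_flip_vertex: "sg_flip (sg_vertex i) = sg_vertex (2 * i)"
proof -
  have "(2 * i) mod 3 = (if i mod 3 = 0 then 0 else if i mod 3 = 1 then 2 else 1)"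
    by presburger
  then show ?thesis
    by (auto simp: sg_flip_def sg_vertex_def)
qed

lemma sg_vertex_4 [simp]: "sg_vertex 4 = sg_vertex 1" and sg_map_4 [simp]: "sg_map 4 = sg_map 1"
  using sg_vertex_mod [of 4] sg_map_mod [of 4] by simp_all

lemma sg_flip_in_SG [simp]: "sg_flip x \<in> SG \<longleftrightarrow> x \<in> SG"
proof -
  have "sg_attractor (sg_flip ` SG)"
    unfolding sg_attractor_def
  proof (intro conjI)
    show "sg_flip ` SG \<noteq> {}"
      using SG_nonempty by simp
    show "compact (sg_flip ` SG)"
      by (intro compact_continuous_image compact_SG continuous_intros)
    have "sg_flip ` SG = sg_flip ` (\<Union>i<3. sg_map i ` SG)"
      using SG_invariant by simp
    also have "\<dots> = (\<Union>i<3. sg_map i ` sg_flip ` SG)"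
      by (simp add: lessThan_3 image_Un image_image sg_flip_map Un_ac)
    finally show "sg_flip ` SG = (\<Union>i<3. sg_map i ` sg_flip ` SG)" .
  qed
  then have "SG = sg_flip ` SG"
    by (rule SG_unique)
  then show ?thesis
    by (metis imageE imageI sg_flip_flip)
qed

text \<open>Since the reflection permutes the three maps and preserves \<open>SG\<close>, the image
  measure is again self-similar with full mass on \<open>SG\<close>, and uniqueness applies.\<close>

lemma distr_sg_flip: "distr sg_measure borel sg_flip = sg_measure"
proof (rule sg_selfsimilar_unique)
  have vim: "sg_flip -` A \<in> sets borel" if "A \<in> sets borel" for A
    using measurable_sets [OF borel_measurable_sg_flip that] by simp
  have meas: "measure (distr sg_measure borel sg_flip) A = measure sg_measure (sg_flip -` A)"
    if "A \<in> sets borel" for A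
    using that by (subst measure_distr) auto
  show "sg_selfsimilar (distr sg_measure borel sg_flip)"
    unfolding sg_selfsimilar_def
  proof (intro conjI ballI)
    show "prob_space (distr sg_measure borel sg_flip)"
      by (rule sg_measure.prob_space_distr) measurable
    fix A :: "plane set" assume A: "A \<in> sets borel"
    have eq: "sg_flip -` (sg_map i -` A) = sg_map (2 * i) -` (sg_flip -` A)" for i
    proof -
      have "(2 * (2 * i)) mod 3 = i mod 3"
        by presburger
      then have "sg_map (2 * (2 * i)) = sg_map i"
        by (metis sg_map_mod)
      then show ?thesis
        by (simp add: vimage_def sg_flip_map)
    qed
    show "measure (distr sg_measure borel sg_flip) A =
        (\<Sum>i<3. measure (distr sg_measure borel sg_flip) (sg_map i -` A)) / 3"
      using sg_selfsimilarD(4) [OF sg_measure_properties(1) vim [OF A]] A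
      by (simp add: meas sg_map_vimage_borel sum_less_3 eq)
  qed simp
  have "sg_flip -` SG = SG"
    by (simp add: set_eq_iff del: split_paired_All)
  then show "measure (distr sg_measure borel sg_flip) SG = 1"
    using sg_measure_properties(2) by (simp add: meas)
qed (rule sg_measure_properties)+

section \<open>Integrals of continuous functions over the gasket\<close>

lemma set_borel_measurable_SG:
  "continuous_on SG f \<Longrightarrow> (\<lambda>x. indicator SG x *\<^sub>R f x :: real) \<in> borel_measurable borel"
  by (rule borel_measurable_continuous_on_indicator) measurable

lemma set_integrable_SG:
  fixes f :: "plane \<Rightarrow> real"
  assumes "continuous_on SG f" shows "set_integrable sg_measure SG f"
proof -
  have "bounded (f ` SG)"
    by (intro compact_imp_bounded compact_continuous_image assms compact_SG)
  then obtain B where B: "\<And>x. x \<in> SG \<Longrightarrow> \<bar>f x\<bar> \<le> B"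
    by (auto simp: bounded_iff)
  have "\<bar>indicator SG x *\<^sub>R f x\<bar> \<le> \<bar>B\<bar>" for x
    using B [of x] by (auto simp: indicator_def)
  then show ?thesis
    unfolding set_integrable_def
    using set_borel_measurable_SG [OF assms]
    by (intro sg_measure.integrable_const_bound [where B = "\<bar>B\<bar>"]) auto
qed

lemma sg_integral_cong:
  "(\<And>x. x \<in> SG \<Longrightarrow> f x = g x) \<Longrightarrow> (LINT x:SG|sg_measure. f x :: real) = (LINT x:SG|sg_measure. g x)"
  by (rule set_lebesgue_integral_cong) auto

lemma sg_integral_linear:
  fixes f g :: "plane \<Rightarrow> real"
  assumes "continuous_on SG f" "continuous_on SG g"
  shows "(LINT x:SG|sg_measure. a * f x + b * g x) =
     a * (LINT x:SG|sg_measure. f x) + b * (LINT x:SG|sg_measure. g x)"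
  using set_integrable_SG [OF assms(1)] set_integrable_SG [OF assms(2)]
  by (subst set_integral_add) auto

lemma sg_integral_flip:
  fixes f :: "plane \<Rightarrow> real"
  assumes "continuous_on SG f"
  shows "(LINT x:SG|sg_measure. f (sg_flip x)) = (LINT x:SG|sg_measure. f x)"
proof -
  have "(LINT x:SG|sg_measure. f x) = (LINT x|distr sg_measure borel sg_flip. indicator SG x *\<^sub>R f x)"
    by (simp add: set_lebesgue_integral_def distr_sg_flip)
  also have "\<dots> = (LINT x|sg_measure. indicator SG (sg_flip x) *\<^sub>R f (sg_flip x))"
    using set_borel_measurable_SG [OF assms] by (intro integral_distr) auto
  finally show ?thesis
    by (simp add: set_lebesgue_integral_def indicator_def)
qed

lemma small_cell:
  assumes "x \<in> SG" "\<delta> > 0"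
  obtains w r where "w \<in> sg_words r" "x \<in> sg_cell w" "sg_cell w \<subseteq> ball x \<delta>"
proof -
  have "\<exists>w\<in>sg_words r. x \<in> sg_cell w \<and> (\<forall>y\<in>sg_cell w. dist x y \<le> 2 / 2 ^ r)" if "x \<in> SG" for r x
    using that
  proof (induction r arbitrary: x)
    case 0
    then show ?case using dist_SG_le by simp
  next
    case (Suc r)
    then obtain i y where y: "i < 3" "y \<in> SG" "x = sg_map i y"
      by (auto elim: SG_cases)
    obtain w where w: "w \<in> sg_words r" "y \<in> sg_cell w" "\<And>z. z \<in> sg_cell w \<Longrightarrow> dist y z \<le> 2 / 2 ^ r"
      using Suc.IH [OF y(2)] by blast
    have "dist x z \<le> 2 / 2 ^ Suc r" if "z \<in> sg_cell (i # w)" for z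
      using that w(3) y(3) by (auto simp: sg_cell_Cons)
    moreover have "i # w \<in> sg_words (Suc r)" "x \<in> sg_cell (i # w)"
      using y w by (auto simp: sg_words_Suc sg_cell_Cons)
    ultimately show ?case by blast
  qed
  moreover obtain r where "2 / 2 ^ r < \<delta>"
    using order_tendstoD(2) [OF LIMSEQ_divide_realpow_zero [of 2 2] assms(2)]
    by (auto simp: eventually_sequentially)
  ultimately show ?thesis
    using that assms(1) by (meson mem_ball order.strict_trans1 subsetI)
qed

text \<open>By continuity \<open>f\<close> is at least half of \<open>f x\<close> on a small cell
  containing \<open>x\<close>, and cells have positive mass.\<close>

lemma sg_integral_pos:
  fixes f :: "plane \<Rightarrow> real"
  assumes f: "continuous_on SG f" "\<And>x. x \<in> SG \<Longrightarrow> f x \<ge> 0" and x: "x \<in> SG" "f x > 0"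
  shows "(LINT x:SG|sg_measure. f x) > 0"
proof -
  obtain \<delta> where \<delta>: "\<delta> > 0" "\<And>y. y \<in> SG \<Longrightarrow> dist y x < \<delta> \<Longrightarrow> dist (f y) (f x) < f x / 2"
    using f(1) x half_gt_zero [OF x(2)] unfolding continuous_on_iff by metis
  obtain w r where w: "w \<in> sg_words r" "x \<in> sg_cell w" "sg_cell w \<subseteq> ball x \<delta>"
    using small_cell [OF x(1) \<delta>(1)] .
  have "f x / 2 \<le> f y" if "y \<in> sg_cell w" for y
  proof -
    have "y \<in> SG" "dist y x < \<delta>"
      using that w(3) sg_cell_subset_SG [of w] by (auto simp: dist_commute)
    from \<delta>(2) [OF this] show ?thesis
      unfolding dist_real_def by linarith
  qed
  then have "indicator (sg_cell w) y *\<^sub>R (f x / 2) \<le> indicator SG y *\<^sub>R f y" for y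
    using f(2) [of y] sg_cell_subset_SG [of w] by (auto simp: indicator_def)
  then have "(LINT y|sg_measure. indicator (sg_cell w) y *\<^sub>R (f x / 2)) \<le> (LINT y:SG|sg_measure. f y)"
    unfolding set_lebesgue_integral_def
    using set_integrable_SG [OF f(1)] unfolding set_integrable_def
    by (intro integral_mono integrable_scaleR_left integrable_real_indicator)
      (auto simp: less_top [symmetric])
  moreover have "(LINT y|sg_measure. indicator (sg_cell w) y *\<^sub>R (f x / 2)) = f x / 2 * (1 / 3 ^ r)"
    using measure_sg_cell [OF sg_measure_properties w(1)] by simp
  moreover have "f x / 2 * (1 / 3 ^ r) > 0"
    using x(2) by simp
  ultimately show ?thesis
    by linarith
qed

section \<open>The Laplacian and monomials\<close>

lemma has_sg_laplacian_cong:
  assumes "\<And>x. x \<in> SG \<Longrightarrow> u x = u' x" "\<And>x. x \<in> SG \<Longrightarrow> f x = f' x"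
  shows "has_sg_laplacian u f \<longleftrightarrow> has_sg_laplacian u' f'"
proof -
  have "sg_energy u v = sg_energy u' v" for v
    using assms by (intro sg_energy_cong) auto
  moreover have "(LINT x:SG|sg_measure. f x * v x) = (LINT x:SG|sg_measure. f' x * v x)" for v
    using assms by (intro sg_integral_cong) auto
  ultimately show ?thesis
    using sg_dom_energy_cong [of u u'] continuous_on_cong [of SG SG f f'] assms
    by (simp add: has_sg_laplacian_def)
qed

lemma has_sg_laplacian_linear:
  assumes u: "has_sg_laplacian u f" and v: "has_sg_laplacian v g"
  shows "has_sg_laplacian (\<lambda>x. a * u x + b * v x) (\<lambda>x. a * f x + b * g x)"
  unfolding has_sg_laplacian_def
proof (intro conjI ballI impI)
  have uv: "u \<in> sg_dom_energy" "v \<in> sg_dom_energy" "continuous_on SG f" "continuous_on SG g"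
    using u v by (auto simp: has_sg_laplacian_def)
  then show "(\<lambda>x. a * u x + b * v x) \<in> sg_dom_energy" "continuous_on SG (\<lambda>x. a * f x + b * g x)"
    by (auto intro!: sg_dom_energy_linear continuous_intros)
  fix w assume w: "w \<in> sg_dom_energy" "\<forall>x\<in>sg_V0. w x = 0"
  have "sg_energy (\<lambda>x. a * u x + b * v x) w =
      - (a * (LINT x:SG|sg_measure. f x * w x) + b * (LINT x:SG|sg_measure. g x * w x))"
    using u v w uv by (simp add: sg_energy_linear has_sg_laplacian_def)
  also have "\<dots> = - (LINT x:SG|sg_measure. a * (f x * w x) + b * (g x * w x))"
    using uv sg_dom_energy_continuous [OF w(1)]
    by (subst sg_integral_linear) (auto intro!: continuous_intros)
  finally show "sg_energy (\<lambda>x. a * u x + b * v x) w =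
      - (LINT x:SG|sg_measure. (a * f x + b * g x) * w x)"
    by (simp add: algebra_simps)
qed

lemma has_sg_laplacian_zero: "has_sg_laplacian (\<lambda>x. 0) (\<lambda>x. 0)"
  using sg_dom_energy_const [of 0]
  by (simp add: has_sg_laplacian_def sg_energy_def sg_graph_energy_def)

lemma has_sg_laplacian_sum:
  fixes d :: nat
  assumes "\<And>i. i < d \<Longrightarrow> has_sg_laplacian (u i) (f i)"
  shows "has_sg_laplacian (\<lambda>x. \<Sum>i<d. a i * u i x) (\<lambda>x. \<Sum>i<d. a i * f i x)"
  using assms
proof (induction d)
  case 0
  then show ?case by (simp add: has_sg_laplacian_zero)
next
  case (Suc d)
  then show ?case
    using has_sg_laplacian_linear [of "\<lambda>x. \<Sum>i<d. a i * u i x" "\<lambda>x. \<Sum>i<d. a i * f i x"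
        "u d" "f d" 1 "a d"] by simp
qed

text \<open>If \<open>f\<close> exceeded \<open>g\<close> at \<open>x\<close>, it would do so on a
  small cell. The bump transplanted to that cell is an admissible test function, nonnegative and
  positive somewhere, so its integral against f - g is positive; but both Laplacians belong to the
  same \<open>u\<close>, which makes it 0.\<close>

lemma has_sg_laplacian_le:
  assumes f: "has_sg_laplacian u f" and g: "has_sg_laplacian u g" and x: "x \<in> SG"
  shows "f x \<le> g x"
proof (rule ccontr)
  assume neg: "\<not> f x \<le> g x"
  define d where "d = (\<lambda>x. 1 * f x + (-1) * g x)"
  have cont: "continuous_on SG f" "continuous_on SG g" "continuous_on SG d"
    using f g by (auto simp: has_sg_laplacian_def d_def intro!: continuous_intros)
  have dx: "d x > 0"
    using neg by (simp add: d_def)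
  obtain \<delta> where \<delta>: "\<delta> > 0" "\<And>y. y \<in> SG \<Longrightarrow> dist y x < \<delta> \<Longrightarrow> dist (d y) (d x) < d x"
    using cont(3) x dx unfolding continuous_on_iff by metis
  obtain w r where w: "w \<in> sg_words r" "x \<in> sg_cell w" "sg_cell w \<subseteq> ball x \<delta>"
    using small_cell [OF x \<delta>(1)] .
  have d_pos: "d y > 0" if "y \<in> sg_cell w" for y
  proof -
    have "y \<in> SG" "dist y x < \<delta>"
      using that w(3) sg_cell_subset_SG [of w] by (auto simp: dist_commute)
    from \<delta>(2) [OF this] show ?thesis
      unfolding dist_real_def by linarith
  qed
  define v where "v = sg_cell_extend w sg_bump"
  have "set w \<subseteq> {..<3}"
    using w(1) by (simp add: sg_words_def)
  from sg_cell_extend [OF sg_bump_in_dom_energy sg_bump_V0 this]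
  have v: "v \<in> sg_dom_energy" "\<forall>x\<in>sg_V0. v x = 0" "\<And>x. x \<in> SG \<Longrightarrow> v (sg_word_map w x) = sg_bump x"
    "\<And>y. y \<in> SG \<Longrightarrow> y \<notin> sg_cell w \<Longrightarrow> v y = 0"
    by (auto simp: v_def sg_cell_def)
  have "continuous_on SG v"
    using v(1) by (rule sg_dom_energy_continuous)
  then have "(LINT x:SG|sg_measure. d x * v x) =
      1 * (LINT x:SG|sg_measure. f x * v x) + (-1) * (LINT x:SG|sg_measure. g x * v x)"
    using cont by (subst sg_integral_linear [symmetric])
      (auto simp: d_def algebra_simps intro!: continuous_intros)
  also have "\<dots> = 0"
    using f g v(1,2) by (simp add: has_sg_laplacian_def)
  finally have int_0: "(LINT x:SG|sg_measure. d x * v x) = 0" .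
  have v_nonneg: "v y \<ge> 0" if "y \<in> sg_cell w" for y
    using that v(3) sg_bump_nonneg by (auto simp: sg_cell_def)
  have "(LINT x:SG|sg_measure. d x * v x) > 0"
  proof (rule sg_integral_pos)
    show "continuous_on SG (\<lambda>x. d x * v x)"
      by (intro continuous_intros cont \<open>continuous_on SG v\<close>)
    show "d y * v y \<ge> 0" if "y \<in> SG" for y
      using that d_pos [of y] v_nonneg [of y] v(4) [of y] by (cases "y \<in> sg_cell w") auto
    \<comment> \<open>A junction point, where the bump has the value 1.\<close>
    let ?z = "sg_map 0 (sg_vertex 1)"
    show "sg_word_map w ?z \<in> SG"
      by blast
    have "sg_word_map w ?z \<in> sg_cell w"
      unfolding sg_cell_def by blast
    then show "d (sg_word_map w ?z) * v (sg_word_map w ?z) > 0"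
      using d_pos v(3) [of ?z] sg_bump_midpoint by (simp add: sg_map_in_SG)
  qed
  with int_0 show False by simp
qed

lemma has_sg_laplacian_unique:
  "has_sg_laplacian u f \<Longrightarrow> has_sg_laplacian u g \<Longrightarrow> x \<in> SG \<Longrightarrow> f x = g x"
  by (meson has_sg_laplacian_le order.antisym)

lemma sg_laplacian_eq:
  assumes "has_sg_laplacian u f" "x \<in> SG"
  shows "sg_laplacian u x = f x"
proof -
  let ?f = "\<lambda>x. if x \<in> SG then f x else 0"
  have f: "has_sg_laplacian u ?f"
    using assms(1) has_sg_laplacian_cong [of u u f ?f] by simp
  have "sg_laplacian u = ?f"
    unfolding sg_laplacian_def
  proof (rule the_equality)
    show "has_sg_laplacian u ?f \<and> (\<forall>x. x \<notin> SG \<longrightarrow> ?f x = 0)"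
      using f by simp
    fix g assume "has_sg_laplacian u g \<and> (\<forall>x. x \<notin> SG \<longrightarrow> g x = 0)"
    then show "g = ?f"
      using has_sg_laplacian_unique [of u g f] assms(1) by fastforce
  qed
  then show ?thesis
    using assms(2) by simp
qed

lemma has_sg_laplacian_sg_laplacian:
  assumes "has_sg_laplacian u f" shows "has_sg_laplacian u (sg_laplacian u)"
  using assms has_sg_laplacian_cong [of u u f "sg_laplacian u"] sg_laplacian_eq [OF assms] by simp

text \<open>\<open>sg_laplacian\<close> returns a particular representative that may differ from
  \<open>D\<close> off the gasket, so iterates are compared on \<open>SG\<close> only and the
  equation is carried along by congruence.\<close>

lemma sg_laplacian_chain:
  assumes "\<And>n. n < N \<Longrightarrow> has_sg_laplacian (D n) (D (Suc n))"
    and "\<And>x. x \<in> SG \<Longrightarrow> u x = D 0 x" and "n \<le> N" and "x \<in> SG"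
  shows "(sg_laplacian ^^ n) u x = D n x"
  using assms(3,4)
proof (induction n arbitrary: x)
  case 0
  then show ?case using assms(2) by simp
next
  case (Suc n)
  then have "has_sg_laplacian ((sg_laplacian ^^ n) u) (D (Suc n))"
    using assms(1) [of n] has_sg_laplacian_cong [of "(sg_laplacian ^^ n) u" "D n"] by simp
  then show ?case
    using sg_laplacian_eq Suc.prems(2) by simp
qed

text \<open>The difference is harmonic and vanishes on V_0, so it is its own test function: its
  energy is 0 and it is constant.\<close>

lemma sg_dirichlet_unique:
  assumes "has_sg_laplacian u f" "has_sg_laplacian v f"
    and "\<And>x. x \<in> sg_V0 \<Longrightarrow> u x = v x" and "x \<in> SG"
  shows "u x = v x"
proof -
  define w where "w = (\<lambda>x. 1 * u x + (-1) * v x)"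
  have "has_sg_laplacian w (\<lambda>x. 1 * f x + (-1) * f x)"
    unfolding w_def by (intro has_sg_laplacian_linear assms)
  moreover have w0: "\<forall>x\<in>sg_V0. w x = 0"
    using assms(3) by (simp add: w_def)
  ultimately have "w \<in> sg_dom_energy" "sg_energy w w = 0"
    by (auto simp: has_sg_laplacian_def)
  then have "w x = w (sg_vertex 0)"
    using assms(4) by (rule sg_energy_0_imp_const)
  then show ?thesis
    using w0 by (simp add: w_def sg_V0_def)
qed

text \<open>Solvability enters through the witness \<open>u\<close>; uniqueness then identifies the
  description \<open>sg_green f\<close> with \<open>u\<close> on the gasket.\<close>

lemma sg_green:
  assumes "has_sg_laplacian u f" "\<And>x. x \<in> sg_V0 \<Longrightarrow> u x = 0"
  shows "has_sg_laplacian (sg_green f) f"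
    and "x \<in> sg_V0 \<Longrightarrow> sg_green f x = 0"
    and "x \<in> SG \<Longrightarrow> sg_green f x = u x"
proof -
  let ?u = "\<lambda>x. if x \<in> SG then u x else 0"
  have u: "has_sg_laplacian ?u f"
    using assms(1) has_sg_laplacian_cong [of u ?u f f] by simp
  have "sg_green f = ?u"
    unfolding sg_green_def
  proof (rule the_equality)
    show "has_sg_laplacian ?u f \<and> (\<forall>x\<in>sg_V0. ?u x = 0) \<and> (\<forall>x. x \<notin> SG \<longrightarrow> ?u x = 0)"
      using u assms(2) by simp
    fix v assume v: "has_sg_laplacian v f \<and> (\<forall>x\<in>sg_V0. v x = 0) \<and> (\<forall>x. x \<notin> SG \<longrightarrow> v x = 0)"
    then have "v x = u x" if "x \<in> SG" for x
      using sg_dirichlet_unique [of v f u x] assms that by simp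
    with v show "v = ?u" by auto
  qed
  then show "has_sg_laplacian (sg_green f) f" "x \<in> sg_V0 \<Longrightarrow> sg_green f x = 0"
    "x \<in> SG \<Longrightarrow> sg_green f x = u x"
    using u assms(2) by simp_all
qed

section \<open>Reflection invariance of energy and Laplacian\<close>

lemma sg_vertex_Suc_Suc [simp]: "sg_vertex (Suc (Suc 0)) = sg_vertex 2"
  by (simp add: numeral_2_eq_2)

lemma sg_flip_vertices [simp]:
  "sg_flip (sg_vertex 0) = sg_vertex 0" "sg_flip (sg_vertex (Suc 0)) = sg_vertex 2"
  "sg_flip (sg_vertex 2) = sg_vertex (Suc 0)"
  using sg_flip_vertex [of 0] sg_flip_vertex [of 1] sg_flip_vertex [of 2] by simp_all

lemma sg_graph_energy_flip:
  "sg_graph_energy r (\<lambda>x. u (sg_flip x)) (\<lambda>x. v (sg_flip x)) = sg_graph_energy r u v"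
proof (induction r arbitrary: u v)
  case 0
  show ?case
    by (simp add: sg_graph_energy_0 sg_form_def algebra_simps)
next
  case (Suc r)
  have "sg_graph_energy r (\<lambda>x. u (sg_flip (sg_map i x))) (\<lambda>x. v (sg_flip (sg_map i x))) =
      sg_graph_energy r (\<lambda>x. u (sg_map (2 * i) x)) (\<lambda>x. v (sg_map (2 * i) x))" for i
    unfolding sg_flip_map by (rule Suc)
  then show ?case
    by (simp add: sg_graph_energy_Suc sum_less_3)
qed

lemma sg_dom_energy_flip: "u \<in> sg_dom_energy \<Longrightarrow> (\<lambda>x. u (sg_flip x)) \<in> sg_dom_energy"
  by (auto simp: sg_dom_energy_def sg_graph_energy_flip image_subset_iff
      intro!: continuous_on_compose2 [of SG u SG sg_flip] continuous_intros)

lemma sg_flip_V0: "x \<in> sg_V0 \<Longrightarrow> sg_flip x \<in> sg_V0"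
  by (auto simp: sg_V0_def)

text \<open>The reflection is moved onto the test function, where the equation for \<open>u\<close>
  applies, and moved back inside the integral; it preserves energy, measure and V_0.\<close>

lemma has_sg_laplacian_flip:
  assumes u: "has_sg_laplacian u f"
  shows "has_sg_laplacian (\<lambda>x. u (sg_flip x)) (\<lambda>x. f (sg_flip x))"
  unfolding has_sg_laplacian_def
proof (intro conjI ballI impI)
  have f: "continuous_on SG f"
    using u by (simp add: has_sg_laplacian_def)
  show "(\<lambda>x. u (sg_flip x)) \<in> sg_dom_energy"
    using u by (simp add: has_sg_laplacian_def sg_dom_energy_flip)
  show fflip: "continuous_on SG (\<lambda>x. f (sg_flip x))"
    by (rule continuous_on_compose2 [OF f]) (auto intro!: continuous_intros)
  fix v assume v: "v \<in> sg_dom_energy" "\<forall>x\<in>sg_V0. v x = 0"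
  have "sg_energy (\<lambda>x. u (sg_flip x)) v = sg_energy u (\<lambda>x. v (sg_flip x))"
    using sg_graph_energy_flip [of _ u "\<lambda>x. v (sg_flip x)"] by (simp add: sg_energy_def)
  also have "\<dots> = - (LINT x:SG|sg_measure. f x * v (sg_flip x))"
    using u v by (simp add: has_sg_laplacian_def sg_dom_energy_flip sg_flip_V0)
  also have "(LINT x:SG|sg_measure. f x * v (sg_flip x)) = (LINT x:SG|sg_measure. f (sg_flip x) * v x)"
    using sg_integral_flip [of "\<lambda>x. f (sg_flip x) * v x"] fflip sg_dom_energy_continuous [OF v(1)]
    by (simp add: continuous_on_mult)
  finally show "sg_energy (\<lambda>x. u (sg_flip x)) v = - (LINT x:SG|sg_measure. f (sg_flip x) * v x)" .
qed

section \<open>Jets at the top vertex and uniqueness of monomials\<close>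

lemma has_sg_laplacian_hfun: "has_sg_laplacian (hfun v) (\<lambda>x. 0)"
  by (simp add: has_sg_laplacian_def hfun_in_dom_energy sg_energy_hfun sg_form_def sg_V0_def)

text \<open>Sum and difference of the two lower corner values diagonalise the subdivision rule at
  q_0, with eigenvalues 3/5 and 1/5. Their inverses are the scaling factors in the normal and the
  tangential derivative.\<close>

lemma hfun_iterate:
  assumes "v 0 = 0"
  shows "hfun v ((sg_map 0 ^^ r) (sg_vertex 1)) + hfun v ((sg_map 0 ^^ r) (sg_vertex 2)) =
      (3/5) ^ r * (v 1 + v 2)"
    and "hfun v ((sg_map 0 ^^ r) (sg_vertex 1)) - hfun v ((sg_map 0 ^^ r) (sg_vertex 2)) =
      (1/5) ^ r * (v 1 - v 2)"
proof -
  have in_SG: "(sg_map 0 ^^ r) (sg_vertex i) \<in> SG" for r i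
    by (induction r) auto
  have "hfun v ((sg_map 0 ^^ r) (sg_vertex 1)) + hfun v ((sg_map 0 ^^ r) (sg_vertex 2)) =
      (3/5) ^ r * (v 1 + v 2) \<and>
    hfun v ((sg_map 0 ^^ r) (sg_vertex 1)) - hfun v ((sg_map 0 ^^ r) (sg_vertex 2)) =
      (1/5) ^ r * (v 1 - v 2)"
    using assms
  proof (induction r arbitrary: v)
    case 0
    then show ?case by (simp add: hfun_vertex)
  next
    case (Suc r)
    have "hext 0 v 0 = 0" "hext 0 v 1 + hext 0 v 2 = 3/5 * (v 1 + v 2)"
      "hext 0 v 1 - hext 0 v 2 = 1/5 * (v 1 - v 2)"
      using Suc.prems by (simp_all add: hext_def field_simps)
    then show ?case
      using Suc.IH [of "hext 0 v"] by (simp add: hfun_map in_SG)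
  qed
  then show "hfun v ((sg_map 0 ^^ r) (sg_vertex 1)) + hfun v ((sg_map 0 ^^ r) (sg_vertex 2)) =
      (3/5) ^ r * (v 1 + v 2)"
    "hfun v ((sg_map 0 ^^ r) (sg_vertex 1)) - hfun v ((sg_map 0 ^^ r) (sg_vertex 2)) =
      (1/5) ^ r * (v 1 - v 2)"
    by blast+
qed

lemma sg_map_funpow_in_SG [simp]: "x \<in> SG \<Longrightarrow> (sg_map i ^^ r) x \<in> SG"
  by (induction r) auto

lemma has_normal_deriv_cong:
  "(\<And>x. x \<in> SG \<Longrightarrow> u x = v x) \<Longrightarrow> has_normal_deriv u i d \<longleftrightarrow> has_normal_deriv v i d"
  by (simp add: has_normal_deriv_def)

lemma has_tangential_deriv_cong:
  "(\<And>x. x \<in> SG \<Longrightarrow> u x = v x) \<Longrightarrow> has_tangential_deriv u i d \<longleftrightarrow> has_tangential_deriv v i d"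
  by (simp add: has_tangential_deriv_def)

lemma has_normal_deriv_linear:
  assumes "has_normal_deriv u i d" "has_normal_deriv v i e"
  shows "has_normal_deriv (\<lambda>x. a * u x + b * v x) i (a * d + b * e)"
  using tendsto_add [OF tendsto_mult_left [OF assms(1) [unfolded has_normal_deriv_def], of a]
      tendsto_mult_left [OF assms(2) [unfolded has_normal_deriv_def], of b]]
  unfolding has_normal_deriv_def by (simp add: algebra_simps)

lemma has_tangential_deriv_linear:
  assumes "has_tangential_deriv u i d" "has_tangential_deriv v i e"
  shows "has_tangential_deriv (\<lambda>x. a * u x + b * v x) i (a * d + b * e)"
  using tendsto_add [OF tendsto_mult_left [OF assms(1) [unfolded has_tangential_deriv_def], of a]
      tendsto_mult_left [OF assms(2) [unfolded has_tangential_deriv_def], of b]]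
  unfolding has_tangential_deriv_def by (simp add: algebra_simps)

lemma has_normal_deriv_unique: "has_normal_deriv u i d \<Longrightarrow> has_normal_deriv u i e \<Longrightarrow> d = e"
  unfolding has_normal_deriv_def by (rule LIMSEQ_unique)

lemma has_tangential_deriv_unique:
  "has_tangential_deriv u i d \<Longrightarrow> has_tangential_deriv u i e \<Longrightarrow> d = e"
  unfolding has_tangential_deriv_def by (rule LIMSEQ_unique)

lemma sg_flip_funpow: "sg_flip ((sg_map 0 ^^ r) x) = (sg_map 0 ^^ r) (sg_flip x)"
  by (induction r) (simp_all add: sg_flip_map)

lemma has_normal_deriv_flip:
  "has_normal_deriv u 0 d \<Longrightarrow> has_normal_deriv (\<lambda>x. u (sg_flip x)) 0 d"
  by (simp add: has_normal_deriv_def sg_flip_funpow algebra_simps)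

lemma has_tangential_deriv_flip:
  assumes "has_tangential_deriv u 0 d" shows "has_tangential_deriv (\<lambda>x. u (sg_flip x)) 0 (- d)"
  using tendsto_minus [OF assms [unfolded has_tangential_deriv_def]]
  by (simp add: has_tangential_deriv_def sg_flip_funpow algebra_simps)

text \<open>For a harmonic function with value 0 at q_0 the sequences defining the derivatives are
  constant, equal to -(v 1 + v 2) and v 1 - v 2. If both vanish, so do all boundary values.\<close>

lemma harmonic_zero_jet:
  assumes h: "has_sg_laplacian h (\<lambda>x. 0)" and h0: "h (sg_vertex 0) = 0"
    and "has_normal_deriv h 0 0" "has_tangential_deriv h 0 0" and x: "x \<in> SG"
  shows "h x = 0"
proof -
  define v where "v = (\<lambda>i. h (sg_vertex i))"
  have v0: "v 0 = 0"
    using h0 by (simp add: v_def)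
  have eq: "h x = hfun v x" if "x \<in> SG" for x
    by (rule sg_dirichlet_unique [OF h has_sg_laplacian_hfun _ that])
      (auto simp: sg_V0_eq hfun_vertex v_def)
  have "(5/3) ^ r * (2 * h (sg_vertex 0) - h ((sg_map 0 ^^ r) (sg_vertex (0 + 1)))
      - h ((sg_map 0 ^^ r) (sg_vertex (0 + 2)))) = - (v 1 + v 2)" for r
  proof -
    have "(5/3) ^ r * (2 * h (sg_vertex 0) - h ((sg_map 0 ^^ r) (sg_vertex (0 + 1)))
      - h ((sg_map 0 ^^ r) (sg_vertex (0 + 2)))) = - ((5/3) ^ r * ((3/5) ^ r * (v 1 + v 2)))"
      unfolding hfun_iterate(1) [of v, OF v0, symmetric] using h0 by (simp add: eq algebra_simps)
    also have "\<dots> = - (v 1 + v 2)"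
      by (simp add: mult.assoc [symmetric] power_mult_distrib [symmetric] del: minus_add_distrib)
    finally show ?thesis .
  qed
  then have "has_normal_deriv h 0 (- (v 1 + v 2))"
    unfolding has_normal_deriv_def by simp
  then have 1: "- (v 1 + v 2) = 0"
    using assms(3) has_normal_deriv_unique by blast
  have "5 ^ r * (h ((sg_map 0 ^^ r) (sg_vertex (0 + 1)))
      - h ((sg_map 0 ^^ r) (sg_vertex (0 + 2)))) = v 1 - v 2" for r
  proof -
    have "5 ^ r * (h ((sg_map 0 ^^ r) (sg_vertex (0 + 1)))
      - h ((sg_map 0 ^^ r) (sg_vertex (0 + 2)))) = 5 ^ r * ((1/5) ^ r * (v 1 - v 2))"
      unfolding hfun_iterate(2) [of v, OF v0, symmetric] by (simp add: eq algebra_simps)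
    also have "\<dots> = v 1 - v 2"
      by (simp add: power_divide)
    finally show ?thesis .
  qed
  then have "has_tangential_deriv h 0 (v 1 - v 2)"
    unfolding has_tangential_deriv_def by simp
  then have 2: "v 1 - v 2 = 0"
    using assms(4) has_tangential_deriv_unique by blast
  show ?thesis
    by (rule sg_dirichlet_unique [OF h has_sg_laplacian_zero _ x])
      (use 1 2 h0 in \<open>auto simp: sg_V0_def v_def\<close>)
qed

lemma sg_monomial_has_laplacian:
  assumes "is_sg_monomial j k Q" "n \<le> j"
  shows "has_sg_laplacian ((sg_laplacian ^^ n) Q) ((sg_laplacian ^^ Suc n) Q)"
proof -
  have "(sg_laplacian ^^ n) Q \<in> sg_dom_laplacian"
    using assms by (simp add: is_sg_monomial_def)
  then show ?thesis
    using has_sg_laplacian_sg_laplacian by (auto simp: sg_dom_laplacian_def)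
qed

text \<open>Downward induction from \<open>Suc j\<close>, where both iterated Laplacians vanish:
  once those of order \<open>Suc n\<close> agree, the difference of those of order \<open>n\<close>
  is harmonic with zero jet.\<close>

lemma sg_monomial_unique:
  assumes Q: "is_sg_monomial j k Q" and R: "is_sg_monomial j k R" and "x \<in> SG"
  shows "Q x = R x"
proof -
  have "\<forall>x\<in>SG. (sg_laplacian ^^ n) Q x = (sg_laplacian ^^ n) R x" if "n \<le> Suc j" for n
    using that
  proof (induction n rule: inc_induct)
    case base
    show ?case
      using Q R by (simp add: is_sg_monomial_def)
  next
    case (step n)
    then have n: "n \<le> j" by simp
    define h where "h = (\<lambda>x. 1 * (sg_laplacian ^^ n) Q x + (-1) * (sg_laplacian ^^ n) R x)"
    have "has_sg_laplacian h (\<lambda>x. 1 * (sg_laplacian ^^ Suc n) Q x + (-1) * (sg_laplacian ^^ Suc n) R x)"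
      unfolding h_def
      by (intro has_sg_laplacian_linear sg_monomial_has_laplacian [OF Q n] sg_monomial_has_laplacian [OF R n])
    then have "has_sg_laplacian h (\<lambda>x. 0)"
      using step.IH by (subst has_sg_laplacian_cong [of h h _ "\<lambda>x. 1 * (sg_laplacian ^^ Suc n) Q x
          + (-1) * (sg_laplacian ^^ Suc n) R x"]) auto
    moreover have "h (sg_vertex 0) = 0"
      using Q R n by (simp add: is_sg_monomial_def h_def)
    moreover have "has_normal_deriv h 0 (1 * of_bool (n = j \<and> k = 2) + (-1) * of_bool (n = j \<and> k = 2))"
      unfolding h_def using Q R n by (intro has_normal_deriv_linear) (simp_all add: is_sg_monomial_def)
    moreover have "has_tangential_deriv h 0 (1 * of_bool (n = j \<and> k = 3) + (-1) * of_bool (n = j \<and> k = 3))"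
      unfolding h_def using Q R n by (intro has_tangential_deriv_linear) (simp_all add: is_sg_monomial_def)
    ultimately have "h x = 0" if "x \<in> SG" for x
      using harmonic_zero_jet that by simp
    then show ?case
      by (simp add: h_def)
  qed
  from this [of 0] show ?thesis
    using \<open>x \<in> SG\<close> by simp
qed

lemma sg_monomial_laplacian:
  assumes "is_sg_monomial (Suc j) k Q"
  shows "is_sg_monomial j k (sg_laplacian Q)"
proof -
  have *: "(sg_laplacian ^^ n) (sg_laplacian Q) = (sg_laplacian ^^ Suc n) Q" for n
    by (simp add: funpow_swap1)
  show ?thesis
    using assms unfolding is_sg_monomial_def * by (auto simp del: funpow.simps)
qed

text \<open>Allows any chain \<open>D\<close> of successive Laplacians in place of the literal
  iterates of \<open>sg_laplacian\<close>.\<close>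

lemma is_sg_monomialI:
  assumes D: "\<And>n. n \<le> j \<Longrightarrow> has_sg_laplacian (D n) (D (Suc n))"
    and "\<And>x. x \<in> SG \<Longrightarrow> D (Suc j) x = 0"
    and "\<And>n. n \<le> j \<Longrightarrow> D n (sg_vertex 0) = of_bool (n = j \<and> k = 1)"
    and "\<And>n. n \<le> j \<Longrightarrow> has_normal_deriv (D n) 0 (of_bool (n = j \<and> k = 2))"
    and "\<And>n. n \<le> j \<Longrightarrow> has_tangential_deriv (D n) 0 (of_bool (n = j \<and> k = 3))"
  shows "is_sg_monomial j k (D 0)"
proof -
  have eq: "(sg_laplacian ^^ n) (D 0) x = D n x" if "n \<le> Suc j" "x \<in> SG" for n x
    by (rule sg_laplacian_chain [where N = "Suc j"]) (use that D in auto)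
  have "(sg_laplacian ^^ n) (D 0) \<in> sg_dom_laplacian" if "n \<le> j" for n
    using D [OF that] has_sg_laplacian_cong [of "(sg_laplacian ^^ n) (D 0)" "D n" "D (Suc n)" "D (Suc n)"]
      eq [of n] that by (auto simp: sg_dom_laplacian_def)
  moreover have "has_normal_deriv ((sg_laplacian ^^ n) (D 0)) 0 (of_bool (n = j \<and> k = 2))"
    "has_tangential_deriv ((sg_laplacian ^^ n) (D 0)) 0 (of_bool (n = j \<and> k = 3))" if "n \<le> j" for n
    using has_normal_deriv_cong [of "(sg_laplacian ^^ n) (D 0)" "D n"]
      has_tangential_deriv_cong [of "(sg_laplacian ^^ n) (D 0)" "D n"] eq [of n] assms(4,5) that
    by auto
  ultimately show ?thesis
    using eq assms(2,3) unfolding is_sg_monomial_def by (simp del: funpow.simps)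
qed

text \<open>Reflection keeps the normal derivative at q_0 and reverses the tangential one.
  Multiplied by \<open>c\<close>, the reflected monomial satisfies the original specification, so
  uniqueness applies.\<close>

lemma sg_monomial_flip:
  assumes Q: "is_sg_monomial j k Q" and k: "k = 2 \<and> c = 1 \<or> k = 3 \<and> c = -1" and x: "x \<in> SG"
  shows "Q (sg_flip x) = c * Q x"
proof -
  \<comment> \<open>Written with two terms so that the linearity lemmas match literally.\<close>
  define D where "D = (\<lambda>n x. c * (sg_laplacian ^^ n) Q (sg_flip x) + 0 * (sg_laplacian ^^ n) Q (sg_flip x))"
  have "is_sg_monomial j k (D 0)"
  proof (rule is_sg_monomialI)
    fix n assume n: "n \<le> j"
    have jets: "(sg_laplacian ^^ n) Q (sg_vertex 0) = 0"
      "has_normal_deriv ((sg_laplacian ^^ n) Q) 0 (of_bool (n = j \<and> k = 2))"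
      "has_tangential_deriv ((sg_laplacian ^^ n) Q) 0 (of_bool (n = j \<and> k = 3))"
      using Q k n by (auto simp: is_sg_monomial_def)
    show "has_sg_laplacian (D n) (D (Suc n))"
      unfolding D_def
      by (intro has_sg_laplacian_linear has_sg_laplacian_flip sg_monomial_has_laplacian [OF Q n])
    show "D n (sg_vertex 0) = of_bool (n = j \<and> k = 1)"
      using jets(1) k by (auto simp: D_def)
    have "has_normal_deriv (D n) 0 (c * of_bool (n = j \<and> k = 2) + 0 * of_bool (n = j \<and> k = 2))"
      unfolding D_def by (intro has_normal_deriv_linear has_normal_deriv_flip jets)
    then show "has_normal_deriv (D n) 0 (of_bool (n = j \<and> k = 2))"
      using k by auto
    have "has_tangential_deriv (D n) 0 (c * - of_bool (n = j \<and> k = 3) + 0 * - of_bool (n = j \<and> k = 3))"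
      unfolding D_def by (intro has_tangential_deriv_linear has_tangential_deriv_flip jets)
    then show "has_tangential_deriv (D n) 0 (of_bool (n = j \<and> k = 3))"
      using k by auto
  next
    fix x assume "x \<in> SG"
    then show "D (Suc j) x = 0"
      using Q by (simp add: D_def is_sg_monomial_def del: funpow.simps)
  qed
  then have "Q x = D 0 x"
    by (rule sg_monomial_unique [OF Q _ x])
  then show ?thesis
    using k by (auto simp: D_def)
qed

section \<open>Polynomials and orthogonal expansions\<close>

locale sg_monomials =
  fixes k :: nat and P :: "nat \<Rightarrow> plane \<Rightarrow> real"
  assumes k: "k = 2 \<or> k = 3" and monomial: "is_sg_monomial j k (P j)"
begin

definition expands :: "nat \<Rightarrow> (nat \<Rightarrow> real) \<Rightarrow> (plane \<Rightarrow> real) \<Rightarrow> bool" where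
  "expands d a f \<longleftrightarrow> (\<forall>x\<in>SG. f x = (\<Sum>i<d. a i * P i x))"

definition deg_less :: "nat \<Rightarrow> (plane \<Rightarrow> real) \<Rightarrow> bool" where
  "deg_less d f \<longleftrightarrow> (\<exists>a. expands d a f)"

lemma P_laplacian_Suc: "has_sg_laplacian (P (Suc j)) (P j)"
proof -
  have "sg_laplacian (P (Suc j)) x = P j x" if "x \<in> SG" for x
    by (rule sg_monomial_unique [OF sg_monomial_laplacian [OF monomial] monomial that])
  then show ?thesis
    using sg_monomial_has_laplacian [OF monomial, of 0 "Suc j"]
      has_sg_laplacian_cong [of "P (Suc j)" "P (Suc j)" "sg_laplacian (P (Suc j))" "P j"] by simp
qed

lemma P_laplacian_0: "has_sg_laplacian (P 0) (\<lambda>x. 0)"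
proof -
  have "sg_laplacian (P 0) x = 0" if "x \<in> SG" for x
    using monomial [of 0] that by (simp add: is_sg_monomial_def)
  then show ?thesis
    using sg_monomial_has_laplacian [OF monomial, of 0 0]
      has_sg_laplacian_cong [of "P 0" "P 0" "sg_laplacian (P 0)" "\<lambda>x. 0"] by simp
qed

definition P_lap :: "nat \<Rightarrow> plane \<Rightarrow> real" where
  "P_lap i = (case i of 0 \<Rightarrow> (\<lambda>x. 0) | Suc j \<Rightarrow> P j)"

lemma P_lap_simps [simp]: "P_lap 0 = (\<lambda>x. 0)" "P_lap (Suc j) = P j"
  by (simp_all add: P_lap_def)

lemma P_laplacian: "has_sg_laplacian (P i) (P_lap i)"
  by (cases i) (simp_all add: P_laplacian_0 P_laplacian_Suc)

lemma P_vertex_0 [simp]: "P j (sg_vertex 0) = 0"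
  using monomial [of j] k by (auto simp: is_sg_monomial_def)

definition parity :: real where
  "parity = (if k = 2 then 1 else -1)"

lemma P_vertex_2: "P j (sg_vertex 2) = parity * P j (sg_vertex 1)"
  using sg_monomial_flip [OF monomial, of parity "sg_vertex 1" j] k by (auto simp: parity_def)

text \<open>A zero at q_1 would by symmetry give a harmonic function vanishing on V_0, hence
  everywhere, against its derivative 1 at q_0. The value serves as a denominator below.\<close>

lemma P_0_vertex_1: "P 0 (sg_vertex 1) \<noteq> 0"
proof
  assume *: "P 0 (sg_vertex 1) = 0"
  have zero: "P 0 x = 0" if "x \<in> SG" for x
    by (rule sg_dirichlet_unique [OF P_laplacian_0 has_sg_laplacian_zero _ that])
      (use * P_vertex_2 [of 0] in \<open>auto simp: sg_V0_def\<close>)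
  have "has_normal_deriv (P 0) 0 0" "has_tangential_deriv (P 0) 0 0"
    using has_normal_deriv_cong [of "P 0" "\<lambda>x. 0"] has_tangential_deriv_cong [of "P 0" "\<lambda>x. 0"] zero
    by (simp_all add: has_normal_deriv_def has_tangential_deriv_def)
  moreover have "has_normal_deriv (P 0) 0 (of_bool (k = 2))" "has_tangential_deriv (P 0) 0 (of_bool (k = 3))"
    using monomial [of 0] by (auto simp: is_sg_monomial_def)
  ultimately show False
    using k has_normal_deriv_unique has_tangential_deriv_unique by fastforce
qed

definition P_green_coeff :: "nat \<Rightarrow> real" where
  "P_green_coeff i = - P (Suc i) (sg_vertex 1) / P 0 (sg_vertex 1)"

definition P_green :: "nat \<Rightarrow> plane \<Rightarrow> real" where
  "P_green i = (\<lambda>x. 1 * P (Suc i) x + P_green_coeff i * P 0 x)"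

text \<open>By the symmetry of the family, subtracting a single multiple of \<open>P 0\<close> cancels both
  remaining boundary values of \<open>P (Suc i)\<close>.\<close>

lemma P_green: "has_sg_laplacian (P_green i) (P i)" "x \<in> sg_V0 \<Longrightarrow> P_green i x = 0"
proof -
  show "has_sg_laplacian (P_green i) (P i)"
    using has_sg_laplacian_linear [OF P_laplacian_Suc [of i] P_laplacian_0, of 1 "P_green_coeff i"]
    by (simp add: P_green_def)
  show "P_green i x = 0" if "x \<in> sg_V0"
    using that P_0_vertex_1 P_vertex_2 [of 0] P_vertex_2 [of "Suc i"]
    by (auto simp: sg_V0_def P_green_def P_green_coeff_def field_simps)
qed

section \<open>Laplacian and Green operator on spans of monomials\<close>

lemma expands_laplacian:
  "expands d a f \<Longrightarrow> has_sg_laplacian f (\<lambda>x. \<Sum>i<d. a i * P_lap i x)"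
  using has_sg_laplacian_sum [of d P P_lap a, OF P_laplacian]
    has_sg_laplacian_cong [of f "\<lambda>x. \<Sum>i<d. a i * P i x"] by (auto simp: expands_def)

lemma deg_less_cong: "deg_less d f \<Longrightarrow> (\<And>x. x \<in> SG \<Longrightarrow> g x = f x) \<Longrightarrow> deg_less d g"
  by (simp add: deg_less_def expands_def)

lemma deg_less_mono:
  assumes "deg_less d f" "d \<le> e" shows "deg_less e f"
proof -
  obtain a where a: "\<And>x. x \<in> SG \<Longrightarrow> f x = (\<Sum>i<d. a i * P i x)"
    using assms(1) by (auto simp: deg_less_def expands_def)
  have "(\<Sum>i<d. a i * P i x) = (\<Sum>i<e. (if i < d then a i else 0) * P i x)" for x
    using assms(2) by (intro sum.mono_neutral_cong_left) auto
  with a have "expands e (\<lambda>i. if i < d then a i else 0) f"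
    by (auto simp: expands_def)
  then show ?thesis
    by (auto simp: deg_less_def)
qed

lemma deg_less_linear:
  assumes "deg_less d f" "deg_less d g" shows "deg_less d (\<lambda>x. a * f x + b * g x)"
proof -
  obtain p q where "expands d p f" "expands d q g"
    using assms by (auto simp: deg_less_def)
  then have "expands d (\<lambda>i. a * p i + b * q i) (\<lambda>x. a * f x + b * g x)"
    by (simp add: expands_def sum_distrib_left sum.distrib algebra_simps)
  then show ?thesis
    by (auto simp: deg_less_def)
qed

lemma deg_less_zero: "deg_less d (\<lambda>x. 0)"
  by (auto simp: deg_less_def expands_def intro!: exI [of _ "\<lambda>i. 0"])

lemma deg_less_P: "i < d \<Longrightarrow> deg_less d (P i)"
  unfolding deg_less_def expands_def
  by (intro exI [of _ "\<lambda>j. of_bool (j = i)"]) (simp add: of_bool_def if_distrib [of "\<lambda>c. c * _"] cong: if_cong)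

lemma deg_less_sum: "(\<And>i. i < n \<Longrightarrow> deg_less d (u i)) \<Longrightarrow> deg_less d (\<lambda>x. \<Sum>i<n. a i * u i x)"
  for n :: nat
proof (induction n)
  case (Suc n)
  then show ?case
    using deg_less_linear [of d "\<lambda>x. \<Sum>i<n. a i * u i x" "u n" 1 "a n"] by simp
qed (simp add: deg_less_zero)

lemma deg_less_continuous: "deg_less d f \<Longrightarrow> continuous_on SG f"
  using expands_laplacian [of d _ f] sg_dom_energy_continuous [of f]
  unfolding deg_less_def has_sg_laplacian_def by blast

lemma deg_less_laplacian:
  assumes "deg_less d f" shows "deg_less d (sg_laplacian f)" "has_sg_laplacian f (sg_laplacian f)"
proof -
  obtain a where a: "expands d a f"
    using assms by (auto simp: deg_less_def)
  note * = expands_laplacian [OF a]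
  have "deg_less d (P_lap i)" if "i < d" for i
    using that by (cases i) (simp_all add: deg_less_zero deg_less_P)
  then have "deg_less d (\<lambda>x. \<Sum>i<d. a i * P_lap i x)"
    by (intro deg_less_sum)
  then show "deg_less d (sg_laplacian f)"
    by (rule deg_less_cong) (rule sg_laplacian_eq [OF *])
  show "has_sg_laplacian f (sg_laplacian f)"
    by (rule has_sg_laplacian_sg_laplacian [OF *])
qed

lemma deg_less_laplacian_funpow: "deg_less d f \<Longrightarrow> deg_less d ((sg_laplacian ^^ l) f)"
  by (induction l) (auto intro: deg_less_laplacian)

text \<open>\<open>sg_laplacian\<close> is a total description operator, and linearity is available
  only where Laplacians exist; the span hypotheses provide them for all iterates.\<close>

lemma sg_laplacian_linear:
  assumes "deg_less d u" "deg_less d v" "\<And>x. x \<in> SG \<Longrightarrow> f x = a * u x + b * v x" "x \<in> SG"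
  shows "(sg_laplacian ^^ l) f x = a * (sg_laplacian ^^ l) u x + b * (sg_laplacian ^^ l) v x"
proof (rule sg_laplacian_chain [where N = l])
  fix n
  show "has_sg_laplacian (\<lambda>x. a * (sg_laplacian ^^ n) u x + b * (sg_laplacian ^^ n) v x)
    (\<lambda>x. a * (sg_laplacian ^^ Suc n) u x + b * (sg_laplacian ^^ Suc n) v x)"
    using deg_less_laplacian(2) [OF deg_less_laplacian_funpow [OF assms(1), of n]]
      deg_less_laplacian(2) [OF deg_less_laplacian_funpow [OF assms(2), of n]]
    by (intro has_sg_laplacian_linear) simp_all
qed (use assms in auto)

text \<open>The superposition of the \<open>P_green i\<close> solves the Dirichlet problem for
  \<open>f\<close>, and its multiples of \<open>P 0\<close> are collected in \<open>b 0\<close>. The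
  shift of the other coefficients is recorded because it keeps the leading coefficient.\<close>

lemma expands_green:
  assumes "expands d a f"
  shows "has_sg_laplacian (sg_green f) f" "x \<in> sg_V0 \<Longrightarrow> sg_green f x = 0"
    "\<exists>b. expands (Suc d) b (sg_green f) \<and> (\<forall>i<d. b (Suc i) = a i)"
proof -
  define u where "u = (\<lambda>x. \<Sum>i<d. a i * P_green i x)"
  have "has_sg_laplacian u (\<lambda>x. \<Sum>i<d. a i * P i x)"
    unfolding u_def by (intro has_sg_laplacian_sum P_green)
  then have u: "has_sg_laplacian u f"
    using has_sg_laplacian_cong [of u u f "\<lambda>x. \<Sum>i<d. a i * P i x"] assms by (auto simp: expands_def)
  have u0: "u x = 0" if "x \<in> sg_V0" for x
    using that by (simp add: u_def P_green(2))
  show "has_sg_laplacian (sg_green f) f" "x \<in> sg_V0 \<Longrightarrow> sg_green f x = 0"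
    using sg_green(1,2) [OF u u0] by blast+
  define b where "b = (\<lambda>i. case i of 0 \<Rightarrow> \<Sum>i<d. a i * P_green_coeff i | Suc j \<Rightarrow> a j)"
  have "u x = (\<Sum>i<Suc d. b i * P i x)" for x
    unfolding sum.lessThan_Suc_shift
    by (simp add: u_def b_def P_green_def sum.distrib sum_distrib_left sum_distrib_right algebra_simps)
  then have "expands (Suc d) b (sg_green f)"
    using sg_green(3) [OF u u0] by (simp add: expands_def del: sum.lessThan_Suc)
  then show "\<exists>b. expands (Suc d) b (sg_green f) \<and> (\<forall>i<d. b (Suc i) = a i)"
    by (intro exI [of _ b]) (simp add: b_def)
qed

lemma deg_less_green:
  assumes "deg_less d f"
  shows "has_sg_laplacian (sg_green f) f" "x \<in> sg_V0 \<Longrightarrow> sg_green f x = 0"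
    "deg_less (Suc d) (sg_green f)"
  using assms expands_green [of d _ f] unfolding deg_less_def by blast+

lemma deg_less_green_funpow: "deg_less d f \<Longrightarrow> deg_less (d + r) ((sg_green ^^ r) f)"
  by (induction r) (auto intro: deg_less_green)

lemma sg_green_funpow_monic:
  assumes "expands (Suc d) a f" "a d = 1"
  shows "\<exists>b. expands (Suc (d + r)) b ((sg_green ^^ r) f) \<and> b (d + r) = 1"
proof (induction r)
  case 0
  then show ?case using assms by auto
next
  case (Suc r)
  then show ?case
    using expands_green(3) by fastforce
qed

text \<open>Each Green image is an admissible test function for the equation of the other, so both
  sides are minus the energy of the pair.\<close>

lemma sg_inner_green:
  assumes f: "deg_less d f" and g: "deg_less e g"
  shows "sg_inner (sg_green f) g = sg_inner f (sg_green g)"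
proof -
  note F = deg_less_green(1,2) [OF f] and G = deg_less_green(1,2) [OF g]
  have "- sg_inner f (sg_green g) = sg_energy (sg_green f) (sg_green g)"
    using F(1) G unfolding has_sg_laplacian_def sg_inner_def by auto
  also have "\<dots> = sg_energy (sg_green g) (sg_green f)"
    by (rule sg_energy_commute)
  also have "\<dots> = - sg_inner g (sg_green f)"
    using G(1) F unfolding has_sg_laplacian_def sg_inner_def by auto
  finally show ?thesis
    by (simp add: sg_inner_def mult.commute)
qed

lemma sg_inner_green_funpow:
  assumes "deg_less d f" "deg_less e g"
  shows "sg_inner ((sg_green ^^ r) f) g = sg_inner f ((sg_green ^^ r) g)"
  using assms(2)
proof (induction r arbitrary: e g)
  case (Suc r)
  have "sg_inner ((sg_green ^^ Suc r) f) g = sg_inner ((sg_green ^^ r) f) (sg_green g)"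
    using sg_inner_green [OF deg_less_green_funpow [OF assms(1)] Suc.prems] by simp
  also have "\<dots> = sg_inner f ((sg_green ^^ r) (sg_green g))"
    by (rule Suc.IH [OF deg_less_green(3) [OF Suc.prems]])
  finally show ?case
    by (simp add: funpow_swap1)
qed simp

lemma sg_laplacian_green_funpow:
  assumes "deg_less d f" "l \<le> r" "x \<in> SG"
  shows "(sg_laplacian ^^ l) ((sg_green ^^ r) f) x = (sg_green ^^ (r - l)) f x"
proof (rule sg_laplacian_chain [where N = r])
  fix n assume "n < r"
  then have "r - n = Suc (r - Suc n)" by simp
  then show "has_sg_laplacian ((sg_green ^^ (r - n)) f) ((sg_green ^^ (r - Suc n)) f)"
    using deg_less_green(1) [OF deg_less_green_funpow [OF assms(1)]] by simp
qed (use assms in auto)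

section \<open>Sobolev inner products\<close>

lemma sg_inner_linear:
  assumes "continuous_on SG u" "continuous_on SG v" "continuous_on SG g"
    and "\<And>x. x \<in> SG \<Longrightarrow> f x = a * u x + b * v x"
  shows "sg_inner f g = a * sg_inner u g + b * sg_inner v g"
proof -
  have "sg_inner f g = (LINT x:SG|sg_measure. a * (u x * g x) + b * (v x * g x))"
    unfolding sg_inner_def using assms(4) by (intro sg_integral_cong) (simp add: algebra_simps)
  also have "\<dots> = a * sg_inner u g + b * sg_inner v g"
    unfolding sg_inner_def using assms by (intro sg_integral_linear continuous_intros)
  finally show ?thesis .
qed

lemma sg_sobolev_inner_alt:
  "sg_sobolev_inner m chi f g =
     (\<Sum>l\<le>m. chi l * sg_inner ((sg_laplacian ^^ l) f) ((sg_laplacian ^^ l) g))"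
  by (simp add: sg_sobolev_inner_def sg_inner_def)

lemma sg_sobolev_inner_commute: "sg_sobolev_inner m chi f g = sg_sobolev_inner m chi g f"
  by (simp add: sg_sobolev_inner_def mult.commute)

text \<open>Lets the orthogonality results for Sobolev products serve the Legendre family as the
  case m = 0.\<close>

lemma sg_sobolev_inner_0: "sg_sobolev_inner 0 (\<lambda>l. 1) = sg_inner"
  by (simp add: sg_sobolev_inner_alt fun_eq_iff)

lemma sg_sobolev_inner_linear:
  assumes "deg_less d u" "deg_less d v" "deg_less d g"
    and "\<And>x. x \<in> SG \<Longrightarrow> f x = a * u x + b * v x"
  shows "sg_sobolev_inner m chi f g = a * sg_sobolev_inner m chi u g + b * sg_sobolev_inner m chi v g"
proof -
  have deg: "deg_less d ((sg_laplacian ^^ l) u)" "deg_less d ((sg_laplacian ^^ l) v)"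
    "deg_less d ((sg_laplacian ^^ l) g)" for l
    using assms by (auto intro: deg_less_laplacian_funpow)
  have "sg_inner ((sg_laplacian ^^ l) f) ((sg_laplacian ^^ l) g) =
      a * sg_inner ((sg_laplacian ^^ l) u) ((sg_laplacian ^^ l) g) +
      b * sg_inner ((sg_laplacian ^^ l) v) ((sg_laplacian ^^ l) g)" for l
    using sg_laplacian_linear [OF assms(1,2,4)]
    by (intro sg_inner_linear deg_less_continuous [OF deg(1)] deg_less_continuous [OF deg(2)]
        deg_less_continuous [OF deg(3)])
  then show ?thesis
    by (simp add: sg_sobolev_inner_alt sum_distrib_left sum.distrib algebra_simps)
qed

lemma sg_sobolev_inner_sum:
  fixes n :: nat
  assumes "\<And>i. i < n \<Longrightarrow> deg_less d (u i)" "deg_less d g"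
    and "\<And>x. x \<in> SG \<Longrightarrow> f x = (\<Sum>i<n. a i * u i x)"
  shows "sg_sobolev_inner m chi f g = (\<Sum>i<n. a i * sg_sobolev_inner m chi (u i) g)"
  using assms(1,3)
proof (induction n arbitrary: f)
  case 0
  then show ?case
    using sg_sobolev_inner_linear [OF deg_less_zero deg_less_zero assms(2), of f 0 0 m chi] by simp
next
  case (Suc n)
  let ?h = "\<lambda>x. \<Sum>i<n. a i * u i x"
  have "sg_sobolev_inner m chi f g = 1 * sg_sobolev_inner m chi ?h g + a n * sg_sobolev_inner m chi (u n) g"
    using Suc.prems by (intro sg_sobolev_inner_linear [where d = d] deg_less_sum assms(2)) auto
  then show ?case
    using Suc.IH [of ?h] Suc.prems(1) by simp
qed

text \<open>All terms are nonnegative, so the one of order 0, of weight 1, bounds the form from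
  below; it is positive for a continuous function that is nonzero at a point of
  \<open>SG\<close>.\<close>

lemma sg_sobolev_inner_definite:
  assumes f: "deg_less d f" and chi: "chi 0 = 1" "\<forall>l\<in>{1..m}. chi l \<ge> 0"
    and 0: "sg_sobolev_inner m chi f f = 0" and x: "x \<in> SG"
  shows "f x = 0"
proof (rule ccontr)
  assume "f x \<noteq> 0"
  \<comment> \<open>Holds for arbitrary \<open>h\<close>, as a non-integrable integrand has integral
    0 by convention.\<close>
  have nonneg: "sg_inner h h \<ge> 0" for h
    unfolding sg_inner_def set_lebesgue_integral_def by (intro Bochner_Integration.integral_nonneg) simp
  have "sg_inner f f > 0"
    unfolding sg_inner_def
    using deg_less_continuous [OF f] \<open>f x \<noteq> 0\<close> x
    by (intro sg_integral_pos [of _ x]) (auto intro!: continuous_intros simp: zero_less_mult_iff linorder_neq_iff)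
  moreover have "chi 0 * sg_inner ((sg_laplacian ^^ 0) f) ((sg_laplacian ^^ 0) f) \<le> sg_sobolev_inner m chi f f"
    unfolding sg_sobolev_inner_alt
  proof (rule member_le_sum)
    fix l assume "l \<in> {..m} - {0}"
    then show "chi l * sg_inner ((sg_laplacian ^^ l) f) ((sg_laplacian ^^ l) f) \<ge> 0"
      using chi(2) nonneg by (intro mult_nonneg_nonneg) auto
  qed auto
  ultimately show False
    using 0 chi(1) by simp
qed

section \<open>Monic orthogonal families and the expansion\<close>

lemma orthogonal_polys_deg_less:
  assumes "monic_orthogonal_polys ip P s"
  shows "deg_less (Suc n) (s n)"
    and "\<exists>a. expands (Suc n) a (s n) \<and> a n = 1"
proof -
  obtain c where c: "\<forall>x\<in>SG. s n x = P n x + (\<Sum>i<n. c i * P i x)"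
    using assms unfolding monic_orthogonal_polys_def by blast
  then have "expands (Suc n) (c (n := 1)) (s n)"
    by (simp add: expands_def)
  then show "deg_less (Suc n) (s n)" "\<exists>a. expands (Suc n) a (s n) \<and> a n = 1"
    by (auto simp: deg_less_def intro!: exI [of _ "c (n := 1)"])
qed

lemma orthogonal_polys_orthogonal:
  assumes "monic_orthogonal_polys (sg_sobolev_inner m chi) P s" "deg_less n g"
  shows "sg_sobolev_inner m chi (s n) g = 0"
proof -
  obtain b where b: "expands n b g"
    using assms(2) by (auto simp: deg_less_def)
  have "sg_sobolev_inner m chi g (s n) = (\<Sum>i<n. b i * sg_sobolev_inner m chi (P i) (s n))"
    using b by (intro sg_sobolev_inner_sum [where d = "Suc n"] deg_less_P orthogonal_polys_deg_less [OF assms(1)])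
      (auto simp: expands_def)
  also have "\<dots> = 0"
    using assms(1) by (auto simp: monic_orthogonal_polys_def sg_sobolev_inner_commute [of _ _ "P _"])
  finally show ?thesis
    by (simp add: sg_sobolev_inner_commute)
qed

text \<open>Monicity lets the top monomial be peeled off: subtracting \<open>a d\<close> times
  \<open>s d\<close> leaves a combination of lower monomials.\<close>

lemma orthogonal_polys_expand:
  assumes s: "monic_orthogonal_polys ip P s" and "deg_less d f"
  shows "\<exists>c. \<forall>x\<in>SG. f x = (\<Sum>i<d. c i * s i x)"
  using assms(2)
proof (induction d arbitrary: f)
  case 0
  then show ?case by (auto simp: deg_less_def expands_def)
next
  case (Suc d)
  obtain a where a: "\<And>x. x \<in> SG \<Longrightarrow> f x = (\<Sum>i<d. a i * P i x) + a d * P d x"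
    using Suc.prems by (auto simp: deg_less_def expands_def)
  obtain b where b: "\<And>x. x \<in> SG \<Longrightarrow> s d x = P d x + (\<Sum>i<d. b i * P i x)"
    using s unfolding monic_orthogonal_polys_def by blast
  have "f x - a d * s d x = (\<Sum>i<d. (a i - a d * b i) * P i x)" if "x \<in> SG" for x
    using a b that by (simp add: sum_distrib_left sum_subtractf algebra_simps)
  then have "deg_less d (\<lambda>x. f x - a d * s d x)"
    by (auto simp: deg_less_def expands_def)
  from Suc.IH [OF this] obtain c where c: "\<And>x. x \<in> SG \<Longrightarrow> f x - a d * s d x = (\<Sum>i<d. c i * s i x)"
    by blast
  have "f x = (\<Sum>i<Suc d. (c (d := a d)) i * s i x)" if "x \<in> SG" for x
    using c [OF that] by simp
  then show ?case by blast
qed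

lemma green_orthogonal:
  assumes p: "monic_orthogonal_polys sg_inner P p" and g: "deg_less e g" "e + m \<le> j"
  shows "sg_sobolev_inner m chi ((sg_green ^^ m) (p j)) g = 0"
proof -
  have p_deg: "deg_less (Suc j) (p j)"
    by (rule orthogonal_polys_deg_less [OF p])
  have "sg_inner ((sg_laplacian ^^ l) ((sg_green ^^ m) (p j))) ((sg_laplacian ^^ l) g) = 0" if "l \<le> m" for l
  proof -
    have "sg_inner ((sg_laplacian ^^ l) ((sg_green ^^ m) (p j))) ((sg_laplacian ^^ l) g) =
        sg_inner ((sg_green ^^ (m - l)) (p j)) ((sg_laplacian ^^ l) g)"
      unfolding sg_inner_def using that
      by (intro sg_integral_cong) (simp add: sg_laplacian_green_funpow [OF p_deg])
    also have "\<dots> = sg_inner (p j) ((sg_green ^^ (m - l)) ((sg_laplacian ^^ l) g))"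
      by (rule sg_inner_green_funpow [OF p_deg deg_less_laplacian_funpow [OF g(1)]])
    also have "\<dots> = 0"
    proof -
      \<comment> \<open>The Laplacian keeps a span and each Green operator enlarges it by one, so
        the bound is e + (m - l); it is largest for l = 0, where e + m <= j is just enough.\<close>
      have "deg_less j ((sg_green ^^ (m - l)) ((sg_laplacian ^^ l) g))"
        by (rule deg_less_mono [OF deg_less_green_funpow [OF deg_less_laplacian_funpow [OF g(1)]]])
          (use g(2) in simp)
      then show ?thesis
        using orthogonal_polys_orthogonal [of 0 "\<lambda>l. 1" p j] p by (simp add: sg_sobolev_inner_0)
    qed
    finally show ?thesis .
  qed
  then show ?thesis
    by (simp add: sg_sobolev_inner_alt)
qed

lemma green_expansion:
  fixes m j :: nat
  assumes chi: "chi 0 = 1" "\<forall>l\<in>{1..m}. chi l \<ge> 0"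
    and p: "monic_orthogonal_polys sg_inner P p"
    and s: "monic_orthogonal_polys (sg_sobolev_inner m chi) P s"
  defines "F \<equiv> (sg_green ^^ m) (p j)" and "S \<equiv> sg_sobolev_inner m chi"
  assumes x: "x \<in> SG"
  shows "F x = s (m + j) x + (\<Sum>i<m + j. S F (s i) / S (s i) (s i) * s i x)"
    and "i + m < j \<Longrightarrow> S F (s i) = 0"
proof -
  define N where "N = m + j"
  obtain a where "expands (Suc j) a (p j)" "a j = 1"
    using orthogonal_polys_deg_less(2) [OF p] by blast
  from sg_green_funpow_monic [OF this, of m] obtain b where b: "expands (Suc N) b F" "b N = 1"
    by (auto simp: F_def N_def add.commute)
  obtain c where c: "expands (Suc N) c (s N)" "c N = 1"
    using orthogonal_polys_deg_less(2) [OF s] by blast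
  \<comment> \<open>The leading coefficients \<open>b N\<close> and \<open>c N\<close> are both 1
    and cancel.\<close>
  have "F x - s N x = (\<Sum>i<N. (b i - c i) * P i x)" if "x \<in> SG" for x
    using b c that by (simp add: expands_def sum_subtractf algebra_simps)
  then have "deg_less N (\<lambda>x. F x - s N x)"
    by (auto simp: deg_less_def expands_def)
  then obtain e where e: "\<And>x. x \<in> SG \<Longrightarrow> F x - s N x = (\<Sum>i<N. e i * s i x)"
    using orthogonal_polys_expand [OF s] by blast
  have s_deg: "deg_less (Suc N) (s i)" if "i \<le> N" for i
    by (rule deg_less_mono [OF orthogonal_polys_deg_less(1) [OF s]]) (use that in simp)
  have orth: "S (s i) (s i') = 0" if "i' < i" for i i'
    unfolding S_def
    by (rule orthogonal_polys_orthogonal [OF s], rule deg_less_mono [OF orthogonal_polys_deg_less(1) [OF s]])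
      (use that in simp)
  have coeff: "S F (s i) = e i * S (s i) (s i)" if i: "i < N" for i
  proof -
    let ?e = "e (N := 1)"
    have "S F (s i) = (\<Sum>i'<Suc N. ?e i' * S (s i') (s i))"
      unfolding S_def
    proof (rule sg_sobolev_inner_sum [where d = "Suc N"])
      show "F x = (\<Sum>i<Suc N. ?e i * s i x)" if "x \<in> SG" for x
        using e [OF that] by simp
    qed (use s_deg i in auto)
    also have "\<dots> = (\<Sum>i'<Suc N. if i' = i then e i * S (s i) (s i) else 0)"
    proof (rule sum.cong [OF refl])
      fix i'
      have "S (s i') (s i) = 0" if "i' \<noteq> i"
        using that orth [of i i'] orth [of i' i] sg_sobolev_inner_commute [of m chi "s i" "s i'"]
        by (auto simp: S_def linorder_neq_iff)
      then show "?e i' * S (s i') (s i) = (if i' = i then e i * S (s i) (s i) else 0)"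
        using i by auto
    qed
    also have "\<dots> = e i * S (s i) (s i)"
      using i by simp
    finally show ?thesis .
  qed
  have "e i * s i x = S F (s i) / S (s i) (s i) * s i x" if i: "i < N" for i
  \<comment> \<open>If the norm is 0, the quotient is 0 by convention and definiteness gives
    \<open>s i x = 0\<close>, so both sides vanish.\<close>
  proof (cases "S (s i) (s i) = 0")
    case True
    then have "s i x = 0"
      using sg_sobolev_inner_definite [OF orthogonal_polys_deg_less(1) [OF s] chi] x by (simp add: S_def)
    then show ?thesis by simp
  next
    case False
    then show ?thesis using coeff [OF i] by simp
  qed
  then show "F x = s (m + j) x + (\<Sum>i<m + j. S F (s i) / S (s i) (s i) * s i x)"
    using e [OF x] by (simp add: N_def)
  show "S F (s i) = 0" if "i + m < j"
    unfolding S_def F_def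
    by (rule green_orthogonal [OF p orthogonal_polys_deg_less(1) [OF s]]) (use that in simp)
qed

end

theorem theorem3p5:
  fixes m k :: nat and chi :: "nat \<Rightarrow> real"
    and P p :: "nat \<Rightarrow> plane \<Rightarrow> real"
    and s F :: "int \<Rightarrow> plane \<Rightarrow> real"
    and n :: int
  assumes "m \<ge> 2" and "k = 2 \<or> k = 3"
    and "chi 0 = 1" and "\<forall>l\<in>{1..m}. chi l \<ge> 0"
    and "\<forall>j. is_sg_monomial j k (P j)"
    and "monic_orthogonal_polys sg_inner P p"
    and "monic_orthogonal_polys (sg_sobolev_inner m chi) P (\<lambda>j. s (int j))"
    and "\<forall>j<0. s j = (\<lambda>x. 0)"
    and "\<forall>j. F (int (m + j)) = (sg_green ^^ m) (p j)"
    and "n \<ge> -1"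
  shows "\<forall>x\<in>SG. F (n + int m + 1) x = s (n + int m + 1) x +
     (\<Sum>l = 0..2 * m - 1.
        sg_sobolev_inner m chi (F (n + int m + 1)) (s (n + int m - int l)) /
        sg_sobolev_inner m chi (s (n + int m - int l)) (s (n + int m - int l)) *
        s (n + int m - int l) x)"
proof
  interpret sg_monomials k P
    using assms(2,5) by unfold_locales auto
  fix x assume x: "x \<in> SG"
  \<comment> \<open>The bound n >= -1 makes n + 1 a natural number \<open>j\<close>, and the top
    index n + m + 1 becomes \<open>N\<close>.\<close>
  obtain j where j: "n + 1 = int j"
    using \<open>n \<ge> -1\<close> by (metis add.commute add_increasing2 diff_add_cancel diff_ge_0_iff_ge nonneg_int_cases uminus_add_conv_diff)
  define N where "N = m + j"
  have N: "n + int m + 1 = int N"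
    using j by (simp add: N_def)
  have F: "F (int N) = (sg_green ^^ m) (p j)"
    using assms(9) by (simp add: N_def)
  define S where "S = sg_sobolev_inner m chi"
  define t where "t = (\<lambda>i. S (F (int N)) (s i) / S (s i) (s i) * s i x)"
  note expansion = green_expansion [OF assms(3,4,6,7) x, where j = j, folded N_def F S_def]
  \<comment> \<open>Negative indices occur for l >= N; there \<open>s\<close> is the zero function
    and annihilates the term whatever the quotient is.\<close>
  have t_int: "t (int N - 1 - int l) = (if l < N then t (int (N - Suc l)) else 0)" for l
  proof (cases "l < N")
    case True
    then have "int N - 1 - int l = int (N - Suc l)" by simp
    with True show ?thesis by presburger
  next
    case False
    then have "s (int N - 1 - int l) x = 0"
      using assms(8) by simp
    with False show ?thesis by (simp add: t_def)
  qed
  \<comment> \<open>For l >= 2 m the index i = N - 1 - l satisfies i + m < j, which is the range of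
    orthogonality.\<close>
  have t_zero: "t (int (N - Suc l)) = 0" if "2 * m \<le> l" "l < N" for l
  proof -
    have "N - Suc l + m < j"
      using that by (simp add: N_def)
    then show ?thesis
      by (simp only: t_def expansion(2) div_0 mult_zero_left)
  qed
  have "{0..2 * m - 1} = {..<2 * m}"
    using \<open>m \<ge> 2\<close> by auto
  then have "(\<Sum>l = 0..2 * m - 1. t (int N - 1 - int l)) = (\<Sum>l<2 * m. if l < N then t (int (N - Suc l)) else 0)"
    by (simp add: t_int)
  also have "\<dots> = (\<Sum>l\<in>{..<2 * m} \<inter> {..<N}. t (int (N - Suc l)))"
    by (subst sum.inter_restrict) auto
  \<comment> \<open>If 2 m < N, the added terms vanish by orthogonality; otherwise the range is
    already all of l < N.\<close>
  also have "\<dots> = (\<Sum>l<N. t (int (N - Suc l)))"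
  proof (rule sum.mono_neutral_left)
    show "\<forall>l\<in>{..<N} - {..<2 * m} \<inter> {..<N}. t (int (N - Suc l)) = 0"
      using t_zero by (metis DiffD1 DiffD2 IntI lessThan_iff not_le)
  qed auto
  also have "\<dots> = (\<Sum>i<N. t (int i))"
    by (rule sum.nat_diff_reindex)
  finally have "F (int N) x = s (int N) x + (\<Sum>l = 0..2 * m - 1. t (int N - 1 - int l))"
    using expansion(1) by (simp add: t_def)
  moreover have "n + int m - int l = int N - 1 - int l" for l
    using N by simp
  ultimately show "F (n + int m + 1) x = s (n + int m + 1) x +
     (\<Sum>l = 0..2 * m - 1.
        sg_sobolev_inner m chi (F (n + int m + 1)) (s (n + int m - int l)) /
        sg_sobolev_inner m chi (s (n + int m - int l)) (s (n + int m - int l)) *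
        s (n + int m - int l) x)"
    unfolding N by (simp add: t_def S_def)
qed

end
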